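(* Let $G$ be a $2$-connected $[4,2]$-graph of order $n\ge 7$. Then $G$ contains a pancyclic edge, i.e., an edge $e$ such that for every integer $k$ with $3\le k\le n$, $e$ lies in a cycle of length $k$ in $G$.
   Context: All graphs are finite and simple. For a positive integer $s$ and a nonnegative integer $t$, a graph $G$ of order at least $s$ is called an $[s,t]$-graph if every induced subgraph of $G$ on $s$ vertices has at least $t$ edges. A $k$-cycle is a cycle of length $k$. *)

theory Defs
  imports "Graph_Theory.Digraph_Component"
begin

text \<open>
  A finite simple graph is a digraph satisfying the locale \<^locale>\<open>graph\<close>: finite, loop-free,
  without parallel arcs, and symmetric. An undirected edge thus corresponds to a pair of
  mutually reverse arcs; it is represented here by the set of its two ends.
\<close>

definition edge_of :: "('a, 'b) pre_digraph \<Rightarrow> 'b \<Rightarrow> 'a set" where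
  "edge_of G a = {tail G a, head G a}"

definition edges :: "('a, 'b) pre_digraph \<Rightarrow> 'a set set" where
  "edges G = edge_of G ` arcs G"

definition k_connected :: "nat \<Rightarrow> ('a, 'b) pre_digraph \<Rightarrow> bool" where
  "k_connected k G \<longleftrightarrow>
     k < card (verts G) \<and>
     (\<forall>S \<subseteq> verts G. card S < k \<longrightarrow> connected (G \<restriction> (verts G - S)))"

definition bracket_graph :: "nat \<Rightarrow> nat \<Rightarrow> ('a, 'b) pre_digraph \<Rightarrow> bool"
  (\<open>'[_,_']'-graph\<close> [0, 0] 1000) where
  "[s,t]-graph G \<longleftrightarrow>
     0 < s \<and> s \<le> card (verts G) \<and>
     (\<forall>H. induced_subgraph H G \<and> card (verts H) = s \<longrightarrow> t \<le> card (edges H))"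

text \<open>
  \<^const>\<open>pre_digraph.cycle\<close> also admits the closed walk traversing an edge back and forth,
  but its length is 2. In a loop-free symmetric digraph without parallel arcs, the cycles of
  length at least 3 are exactly the oriented versions of the cycles of the undirected graph.
\<close>

definition pancyclic_edge :: "('a, 'b) pre_digraph \<Rightarrow> 'a set \<Rightarrow> bool" where
  "pancyclic_edge G e \<longleftrightarrow>
     e \<in> edges G \<and>
     (\<forall>k. 3 \<le> k \<and> k \<le> card (verts G) \<longrightarrow>
        (\<exists>p. pre_digraph.cycle G p \<and> length p = k \<and> e \<in> edge_of G ` set p))"

end

theory Submission
  imports Defs
begin

text \<open>
  The proof is by induction on the order, with the edge \<open>uv\<close> kept fixed. In a
  \<open>[4,2]\<close>-graph the non-neighbours of a vertex induce a clique minus a matching. Therefore a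
  vertex of degree at least 3 can be inserted into any cycle through \<open>uv\<close> that contains all the
  other vertices, as soon as there are at least 6 of them: otherwise the successors (or the
  predecessors) of its neighbours on the cycle form a forbidden set, or rerouting succeeds after all.
  In a 2-connected \<open>[4,2]\<close>-graph of order at least 8 some vertex of degree at least 3 can be
  deleted without destroying 2-connectedness: a separating pair of vertices leaves exactly two
  sides, both essentially cliques, and a vertex that is not needed to attach the pair to the larger
  side can go. There remain the graphs of order 7, which are settled by a case distinction on
  single edges, recorded as a certificate for each value of the minimum degree.
\<close>

section \<open>Inserting a vertex into a spanning path\<close>

text \<open>When a vertex \<open>a\<close> is put back, only one cycle length is new: the shorter
  cycles through \<open>uv\<close> already lie in \<open>V - {a}\<close>. Degree 3 is what insertion
  needs, because the inserted vertex and the successors of three of its neighbours are four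
  vertices, pairwise non-adjacent if no rerouting exists. The obstacle is that the edge
  \<open>uv\<close> must survive: a cycle may not be opened there, so \<open>v\<close> has no usable
  successor and \<open>u\<close> no usable predecessor. Both versions of the argument fail together
  only when the vertex has exactly three neighbours, two of which are \<open>u\<close> and
  \<open>v\<close>; this configuration gets a rerouting of its own.

  The induction cannot start below order 7: the complete bipartite graph with two parts of size 3 is
  a 2-connected [4,2]-graph of order 6 without a triangle. So at order 7 the edge has to be found
  from scratch, and labelling a vertex of minimum degree and its neighbours first keeps the search
  small.\<close>

locale adjacency =
  fixes E :: "'a \<Rightarrow> 'a \<Rightarrow> bool"
  assumes sym: "E x y \<Longrightarrow> E y x"
    and irrefl: "\<not> E x x"
begin

text \<open>Four vertices spanning at most one edge can be named so that this edge is \<open>ab\<close>.\<close>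

definition sparse_free :: "'a set \<Rightarrow> bool" where
  "sparse_free V \<longleftrightarrow> (\<forall>a b c d. {a, b, c, d} \<subseteq> V \<longrightarrow> distinct [a, b, c, d] \<longrightarrow>
     E a c \<or> E a d \<or> E b c \<or> E b d \<or> E c d)"

text \<open>Connectedness after deleting \<open>s\<close> is phrased through partitions into two
  parts, so that a failure directly hands over the two sides of a cut.\<close>

definition biconn :: "'a set \<Rightarrow> bool" where
  "biconn V \<longleftrightarrow> (\<forall>s\<in>V. \<forall>X Y. X \<noteq> {} \<longrightarrow> Y \<noteq> {} \<longrightarrow> X \<inter> Y = {} \<longrightarrow> X \<union> Y = V - {s} \<longrightarrow>
     (\<exists>x\<in>X. \<exists>y\<in>Y. E x y))"

text \<open>A cycle through the edge \<open>uv\<close> is represented by the \<open>u\<close>-\<open>v\<close> path left after removing that edge.\<close>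

definition upath :: "'a \<Rightarrow> 'a \<Rightarrow> 'a list \<Rightarrow> bool" where
  "upath u v p \<longleftrightarrow> p \<noteq> [] \<and> hd p = u \<and> last p = v \<and> distinct p \<and> successively E p"

text \<open>\<open>k\<close> counts the vertices of the path, which is also the length of the cycle
  obtained by closing it with \<open>uv\<close>.\<close>

definition pancyclic_pair :: "'a set \<Rightarrow> 'a \<Rightarrow> 'a \<Rightarrow> bool" where
  "pancyclic_pair V u v \<longleftrightarrow> E u v \<and>
     (\<forall>k. 3 \<le> k \<longrightarrow> k \<le> card V \<longrightarrow> (\<exists>p. upath u v p \<and> set p \<subseteq> V \<and> length p = k))"

lemma sparse_free_subset: "sparse_free V \<Longrightarrow> W \<subseteq> V \<Longrightarrow> sparse_free W"
  unfolding sparse_free_def by (meson order_trans)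

lemma sparse_freeD:
  assumes "sparse_free V" "{a, b, c, d} \<subseteq> V" "distinct [a, b, c, d]"
  shows "E a c \<or> E a d \<or> E b c \<or> E b d \<or> E c d"
  using assms(1)[unfolded sparse_free_def, rule_format, OF assms(2,3)] .

lemma biconnD:
  assumes "biconn V" "s \<in> V" "X \<noteq> {}" "Y \<noteq> {}" "X \<inter> Y = {}" "X \<union> Y = V - {s}"
  shows "\<exists>x\<in>X. \<exists>y\<in>Y. E x y"
  using assms(1)[unfolded biconn_def, rule_format, OF assms(2-6)] .

lemma not_biconnE:
  assumes "\<not> biconn V"
  obtains s X Y where "s \<in> V" "X \<noteq> {}" "Y \<noteq> {}" "X \<inter> Y = {}" "X \<union> Y = V - {s}"
    "\<forall>x\<in>X. \<forall>y\<in>Y. \<not> E x y"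
  using assms unfolding biconn_def by metis

text \<open>Otherwise \<open>bc\<close> would be the only possible edge on the four vertices. So on
  the non-neighbours of \<open>x\<close>, non-adjacency is a matching.\<close>

lemma nonneighbours_matching:
  assumes "sparse_free V" "{x, a, b, c} \<subseteq> V" "distinct [x, a, b, c]"
    and "\<not> E x a" "\<not> E x b" "\<not> E x c" "\<not> E a b"
  shows "E a c"
proof -
  have "\<not> E b a" "\<not> E b x" "\<not> E c x" "\<not> E a x" using assms(4-7) sym by blast+
  with sparse_freeD[OF assms(1), of b c a x] assms(2,3) have "E c a" by auto
  then show ?thesis by (rule sym)
qed

lemma successively_converse: "successively (\<lambda>x y. E y x) p \<longleftrightarrow> successively E p"
proof -
  have "(\<lambda>x y. E y x) = E" using sym by blast
  then show ?thesis by (rule arg_cong[where f = "\<lambda>R. successively R p"])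
qed

section \<open>Rerouting a path between fixed ends\<close>

lemma upath_splice:
  assumes "upath u v (A @ M @ B)" "A \<noteq> []" "B \<noteq> []" "N \<noteq> []" "distinct N"
    and "set N \<inter> (set A \<union> set B) = {}" "successively E N" "E (last A) (hd N)" "E (last N) (hd B)"
  shows "upath u v (A @ N @ B)"
  using assms unfolding upath_def successively_append_iff by simp blast

text \<open>\<open>hd M\<close> and \<open>c\<close> follow the neighbours \<open>a\<close> and
  \<open>b\<close> of \<open>x\<close> on the path; an edge between them lets the stretch from
  \<open>hd M\<close> to \<open>b\<close> be reversed, which makes room for \<open>x\<close>.
  Conversely, if \<open>x\<close> cannot be inserted, the successors of its neighbours are pairwise
  non-adjacent.\<close>

lemma reroute_hd:
  assumes p: "upath u v (A @ a # M @ b # c # B)" and "M \<noteq> []"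
    and x: "x \<notin> set (A @ a # M @ b # c # B)" and adj: "E x a" "E x b" "E (hd M) c"
  shows "upath u v (A @ a # x # b # rev M @ c # B)"
proof -
  have "E (last M) b" and M: "successively E M"
    using p \<open>M \<noteq> []\<close> by (auto simp: upath_def successively_append_iff successively_Cons)
  then have M: "E b (last M)" "successively E M" "E a x" using adj sym by blast+
  have d: "distinct (A @ a # M @ b # c # B)" using p by (simp add: upath_def)
  have "upath u v ((A @ [a]) @ (M @ [b]) @ c # B)" using p by simp
  then have "upath u v ((A @ [a]) @ (x # b # rev M) @ c # B)"
  proof (rule upath_splice)
    show "distinct (x # b # rev M)" "set (x # b # rev M) \<inter> (set (A @ [a]) \<union> set (c # B)) = {}"
      using d x by auto
    show "successively E (x # b # rev M)"
      using \<open>M \<noteq> []\<close> M adj by (simp add: successively_Cons successively_converse hd_rev)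
  qed (use \<open>M \<noteq> []\<close> M adj in \<open>simp_all add: last_rev\<close>)
  then show ?thesis by simp
qed

text \<open>The mirror image, with the predecessors \<open>a\<close> and \<open>last M\<close> of
  the neighbours \<open>b\<close> and \<open>c\<close> of \<open>x\<close>.\<close>

lemma reroute_last:
  assumes p: "upath u v (A @ a # b # M @ c # B)" and "M \<noteq> []"
    and x: "x \<notin> set (A @ a # b # M @ c # B)" and adj: "E x b" "E x c" "E a (last M)"
  shows "upath u v (A @ a # rev M @ b # x # c # B)"
proof -
  have "E b (hd M)" and M: "successively E M"
    using p \<open>M \<noteq> []\<close> by (auto simp: upath_def successively_append_iff successively_Cons)
  then have M: "E (hd M) b" "successively E M" "E b x" using adj sym by blast+
  have d: "distinct (A @ a # b # M @ c # B)" using p by (simp add: upath_def)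
  have "upath u v ((A @ [a]) @ (b # M) @ c # B)" using p by simp
  then have "upath u v ((A @ [a]) @ (rev M @ [b, x]) @ c # B)"
  proof (rule upath_splice)
    show "distinct (rev M @ [b, x])" "set (rev M @ [b, x]) \<inter> (set (A @ [a]) \<union> set (c # B)) = {}"
      using d x by auto
    show "successively E (rev M @ [b, x])"
      using \<open>M \<noteq> []\<close> M by (simp add: successively_append_iff successively_converse last_rev)
  qed (use \<open>M \<noteq> []\<close> M adj in \<open>simp_all add: hd_rev\<close>)
  then show ?thesis by simp
qed

lemma insert_between:
  assumes "upath u v (A @ a # b # B)" "x \<notin> set (A @ a # b # B)" "E x a" "E x b"
  shows "upath u v (A @ a # x # b # B)"
  using upath_splice[of u v "A @ [a]" "[]" "b # B" "[x]"] assms sym[OF assms(3)]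
  by auto

text \<open>An independent set formed by \<open>x\<close> and three successors, or three
  predecessors, of its neighbours is excluded. What escapes is a path whose two ends and one inner
  vertex are the neighbours of \<open>x\<close>; there the bound 6 leaves three further vertices,
  enough for the matching of non-neighbours to yield two chords that admit \<open>x\<close>.\<close>

lemma insert_vertex:
  assumes p: "upath u v p" and x: "x \<notin> set p" and sf: "sparse_free (insert x (set p))"
    and len: "6 \<le> length p" and deg: "3 \<le> card {y \<in> set p. E x y}"
  shows "\<exists>q. upath u v q \<and> set q = insert x (set p)"
proof (rule ccontr)
  assume no: "\<nexists>q. upath u v q \<and> set q = insert x (set p)"
  have "distinct p" using p by (simp add: upath_def)
  then have "3 \<le> length (filter (E x) p)"
    using deg by (simp add: distinct_card[symmetric])
  then obtain a b c R where abc: "filter (E x) p = a # b # c # R"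
    by (auto simp: Suc_le_length_iff numeral_3_eq_3)
  \<comment> \<open>The path is cut at the first three neighbours of \<open>x\<close>, so that the
    stretches \<open>B\<close> and \<open>C\<close> between them contain no neighbour. Further
    neighbours could only lie in \<open>D\<close>.\<close>
  obtain A P where P: "p = A @ a # P" "E x a" "filter (E x) P = b # c # R"
    using filter_eq_ConsD[OF abc] by metis
  obtain B Q where Q: "P = B @ b # Q" "E x b" "\<forall>z\<in>set B. \<not> E x z" "filter (E x) Q = c # R"
    using filter_eq_ConsD[OF P(3)] by metis
  obtain C D where "Q = C @ c # D" "E x c" "\<forall>z\<in>set C. \<not> E x z"
    using filter_eq_ConsD[OF Q(4)] by metis
  with P Q have pd: "p = A @ a # B @ b # C @ c # D"
    and adj: "E x a" "E x b" "E x c"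
    and BC: "\<forall>z\<in>set B \<union> set C. \<not> E x z"
    by auto
  have dist: "distinct (x # A @ a # B @ b # C @ c # D)"
    using \<open>distinct p\<close> x pd by simp
  have match: "E z1 z3" if "z1 \<in> set p" "z2 \<in> set p" "z3 \<in> set p" "distinct [z1, z2, z3]"
    "\<not> E x z1" "\<not> E x z2" "\<not> E x z3" "\<not> E z1 z2" for z1 z2 z3
    using nonneighbours_matching[OF sf, of x z1 z2 z3] that x by auto
  have noq: "set q \<noteq> insert x (set p)" if "upath u v q" for q
    using no that by blast
  have no_between: "\<not> (E x z1 \<and> E x z2)" if "p = P @ z1 # z2 # Q" for P z1 z2 Q
  proof
    assume "E x z1 \<and> E x z2"
    with that p x have "upath u v (P @ z1 # x # z2 # Q)"
      by (simp add: insert_between)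
    from noq[OF this] that show False by auto
  qed
  have no_hd: "\<not> E (hd M) z3" if "p = P @ z1 # M @ z2 # z3 # Q" "M \<noteq> []" "E x z1" "E x z2"
    for P z1 M z2 z3 Q
  proof
    assume "E (hd M) z3"
    with that p x have "upath u v (P @ z1 # x # z2 # rev M @ z3 # Q)"
      by (simp add: reroute_hd)
    from noq[OF this] that(1) show False by auto
  qed
  have no_last: "\<not> E z1 (last M)" if "p = P @ z1 # z2 # M @ z3 # Q" "M \<noteq> []" "E x z2" "E x z3"
    for P z1 M z2 z3 Q
  proof
    assume "E z1 (last M)"
    with that p x have "upath u v (P @ z1 # rev M @ z2 # x # z3 # Q)"
      by (simp add: reroute_last)
    from noq[OF this] that(1) show False by auto
  qed
  have "B \<noteq> []" using no_between[of A a b "C @ c # D"] pd adj by auto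
  have "C \<noteq> []" using no_between[of "A @ a # B" b c D] pd adj by auto
  have mem: "hd B \<in> set B" "last B \<in> set B" "hd C \<in> set C" "last C \<in> set C"
    using \<open>B \<noteq> []\<close> \<open>C \<noteq> []\<close> by auto
  then have nx: "\<not> E x (hd B)" "\<not> E x (last B)" "\<not> E x (hd C)" "\<not> E x (last C)"
    using BC by blast+
  have memp: "hd B \<in> set p" "last B \<in> set p" "hd C \<in> set p" "last C \<in> set p"
    using mem pd by auto
  have disjBC: "y \<noteq> z" if "y \<in> set B" "z \<in> set C" for y z
    using that dist by auto
  have hd_last: "hd L \<noteq> last L" if l2: "2 \<le> length L" "distinct L" for L :: "'a list"
  proof -
    obtain y z L' where "L = y # z # L'" using l2(1) by (cases L; cases "tl L"; simp)
    with l2(2) show ?thesis using last_in_set[of "z # L'"] by auto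
  qed
  \<comment> \<open>\<open>hd B\<close> and \<open>hd C\<close> are the successors of
    \<open>a\<close> and \<open>b\<close>; below, \<open>last B\<close> and \<open>last C\<close>
    are the predecessors of \<open>b\<close> and \<open>c\<close>.\<close>
  have n1: "\<not> E (hd B) (hd C)"
    using no_hd[of A a B b "hd C" "tl C @ c # D"] pd adj \<open>B \<noteq> []\<close> \<open>C \<noteq> []\<close> by simp
  have n2: "\<not> E (last B) (last C)"
    using no_last[of "A @ a # butlast B" "last B" b C c D] pd adj \<open>C \<noteq> []\<close>
      append_butlast_last_id[OF \<open>B \<noteq> []\<close>]
    by (metis append.assoc append_Cons append_Nil)
  \<comment> \<open>A vertex \<open>d\<close> after \<open>c\<close> would complete three successors
    \<open>hd B\<close>, \<open>hd C\<close>, \<open>d\<close>, independent together with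
    \<open>x\<close>.\<close>
  have D: "D = []"
  proof (rule ccontr)
    assume "D \<noteq> []"
    then obtain d Dt where d: "D = d # Dt" by (cases D) auto
    have "\<not> E x d" using no_between[of "A @ a # B @ b # C" c d Dt] pd adj d by simp
    moreover have "\<not> E (hd B) d"
      using no_hd[of A a "B @ b # C" c d Dt] pd adj d \<open>B \<noteq> []\<close> by simp
    moreover have "\<not> E (hd C) d"
      using no_hd[of "A @ a # B" b C c d Dt] pd adj d \<open>C \<noteq> []\<close> by simp
    moreover have "d \<in> set p" "d \<noteq> hd B" "d \<noteq> hd C" using mem dist d pd by auto
    ultimately show False
      using match[of "hd B" "hd C" d] nx n1 memp disjBC mem by simp
  qed
  \<comment> \<open>Symmetrically, a vertex before \<open>a\<close> would complete three
    predecessors.\<close>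
  have A: "A = []"
  proof (rule ccontr)
    assume "A \<noteq> []"
    define d where "d = last A"
    have d: "A = butlast A @ [d]" using \<open>A \<noteq> []\<close> by (simp add: d_def)
    have "\<not> E x d"
      using no_between[of "butlast A" d a "B @ b # C @ c # D"] pd adj d
      by (metis append.assoc append_Cons append_Nil)
    moreover have "\<not> E d (last C)"
      using no_last[of "butlast A" d a "B @ b # C" c D] pd adj d \<open>C \<noteq> []\<close>
      by (metis append.assoc append_Cons append_Nil append_is_Nil_conv last_append last_ConsR list.distinct(1))
    moreover have "d \<in> set A" using \<open>A \<noteq> []\<close> by (simp add: d_def)
    then have "d \<in> set p" "d \<noteq> last B" "d \<noteq> last C" using mem dist pd by auto
    ultimately show False
      using match[of "last C" "last B" d] nx n2 memp disjBC[of "last B" "last C"] mem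
        sym[of "last C" d] sym[of "last C" "last B"] by auto
  qed
  \<comment> \<open>Now the neighbours of \<open>x\<close> are exactly the ends \<open>a\<close>,
    \<open>c\<close> and the inner vertex \<open>b\<close>; the other vertices, at least three, form
    \<open>B\<close> and \<open>C\<close>.\<close>
  have lBC: "3 \<le> length B + length C" using len pd A D by simp
  have dBC: "distinct B" "distinct C" using dist by auto
  \<comment> \<open>A single vertex of \<open>B\<close> is both first and last, hence non-adjacent
    to the two different ends of \<open>C\<close>, against the matching of non-neighbours.\<close>
  have "2 \<le> length B"
  proof (rule ccontr)
    assume "\<not> 2 \<le> length B"
    then obtain z where "B = [z]" using \<open>B \<noteq> []\<close> by (cases B; cases "tl B"; simp)
    then show False
      using match[of "hd B" "hd C" "last C"] nx n1 n2 memp hd_last[of C] lBC dBC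
        disjBC[of "hd B" "hd C"] disjBC[of "hd B" "last C"] mem by simp
  qed
  have "2 \<le> length C"
  proof (rule ccontr)
    assume "\<not> 2 \<le> length C"
    then obtain z where "C = [z]" using \<open>C \<noteq> []\<close> by (cases C; cases "tl C"; simp)
    then show False
      using match[of "hd C" "hd B" "last B"] nx n1 n2 memp hd_last[of B] lBC dBC mem
        disjBC[of "hd B" "hd C"] disjBC[of "last B" "hd C"] sym[of z "hd B"] sym[of z "last B"]
      by auto
  qed
  then obtain t w W where w: "C = t # w # W" by (cases C; cases "tl C"; simp)
  \<comment> \<open>\<open>hd B\<close> and \<open>t\<close> are matched in the non-adjacency
    matching, so each of them is adjacent to every other non-neighbour of \<open>x\<close>.\<close>
  have "E t (last B)"
    using match[of t "hd B" "last B"] nx n1 memp mem hd_last[OF \<open>2 \<le> length B\<close> dBC(1)] w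
      disjBC[of "hd B" t] disjBC[of "last B" t] sym[of t "hd B"] by auto
  moreover have "E (hd B) w"
    using match[of "hd B" t w] nx n1 mem memp w BC pd dBC(2)
      disjBC[of "hd B" t] disjBC[of "hd B" w] by auto
  moreover have path: "upath u v ([a] @ (B @ b # t # w # W) @ [c])"
    using p pd A D w by simp
  moreover from this have "successively E B" "E b t" "successively E (w # W)" "E (last (w # W)) c"
    unfolding upath_def by (auto simp: successively_append_iff successively_Cons)
  \<comment> \<open>The new path enters \<open>x\<close> from \<open>a\<close>, goes on to
    \<open>b\<close> and \<open>t\<close>, runs through \<open>B\<close> backwards by the chord from
    \<open>t\<close> to \<open>last B\<close>, and returns to \<open>w\<close> by the chord from
    \<open>hd B\<close>.\<close>
  ultimately have "upath u v ([a] @ (x # b # t # rev B @ w # W) @ [c])"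
    using adj dist sym[OF adj(1)] \<open>B \<noteq> []\<close> w
    by (intro upath_splice[OF path])
       (auto simp: successively_append_iff successively_Cons successively_converse hd_rev last_rev)
  from noq[OF this] show False using pd A D w by auto
qed

section \<open>Deleting a vertex\<close>

definition nbrs :: "'a set \<Rightarrow> 'a \<Rightarrow> 'a set" where
  "nbrs V a = {y \<in> V. E a y}"

definition separation :: "'a set \<Rightarrow> 'a \<Rightarrow> 'a \<Rightarrow> 'a set \<Rightarrow> 'a set \<Rightarrow> bool" where
  "separation V x s X Y \<longleftrightarrow> x \<in> V \<and> s \<in> V \<and> x \<noteq> s \<and> X \<noteq> {} \<and> Y \<noteq> {} \<and> X \<inter> Y = {} \<and>
     X \<union> Y = V - {x, s} \<and> (\<forall>p\<in>X. \<forall>q\<in>Y. \<not> E p q)"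

lemma separation_swap_sides: "separation V x s X Y \<Longrightarrow> separation V x s Y X"
  unfolding separation_def by (simp add: Int_commute Un_commute) (use sym in blast)

lemma separation_swap_cut: "separation V x s X Y \<Longrightarrow> separation V s x X Y"
  unfolding separation_def by (auto simp: insert_commute)

text \<open>Otherwise \<open>s\<close> alone would cut \<open>Y\<close> off from
  \<open>insert x X\<close>.\<close>

lemma separation_nbr:
  assumes bi: "biconn V" and sep: "separation V x s X Y"
  shows "\<exists>y\<in>Y. E x y"
proof -
  have *: "s \<in> V" "Y \<noteq> {}" "insert x X \<noteq> {}" "Y \<inter> insert x X = {}" "Y \<union> insert x X = V - {s}"
    using sep unfolding separation_def by auto
  obtain y z where "y \<in> Y" "z \<in> insert x X" "E y z"
    using biconnD[OF bi *(1,2,3,4,5)] by auto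
  moreover have "\<not> E z y" if "z \<in> X" "y \<in> Y" for y z
    using sep that unfolding separation_def by simp
  ultimately show ?thesis using sym by (metis insertE)
qed

text \<open>Both \<open>x\<close> and \<open>s\<close> have a neighbour in \<open>X\<close>. Without
  two disjoint edges, all their edges into \<open>X\<close> end in one vertex \<open>x1\<close>,
  which would then cut \<open>X - {x1}\<close> off from everything else.\<close>

lemma separation_matched:
  assumes bi: "biconn V" and sep: "separation V x s X Y" and "finite X" and card: "2 \<le> card X"
  shows "\<exists>x1\<in>X. \<exists>s1\<in>X. x1 \<noteq> s1 \<and> E x x1 \<and> E s s1"
proof (rule ccontr)
  assume no: "\<not> ?thesis"
  obtain x1 where x1: "x1 \<in> X" "E x x1"
    using separation_nbr[OF bi separation_swap_sides[OF sep]] by auto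
  obtain s1 where s1: "s1 \<in> X" "E s s1"
    using separation_nbr[OF bi separation_swap_cut[OF separation_swap_sides[OF sep]]] by auto
  have x1_only: "z = x1" if "z \<in> X" "E x z \<or> E s z" for z
    using no x1 s1 that by metis
  have "x1 \<in> V" using sep x1 unfolding separation_def by auto
  moreover have "X - {x1} \<noteq> {}"
  proof
    assume "X - {x1} = {}"
    then have "card X \<le> card {x1}" by (intro card_mono) auto
    with card show False by simp
  qed
  moreover have "Y \<union> {x, s} \<noteq> {}" by simp
  moreover have "(X - {x1}) \<inter> (Y \<union> {x, s}) = {}" "(X - {x1}) \<union> (Y \<union> {x, s}) = V - {x1}"
    using sep x1 unfolding separation_def by auto
  ultimately have "\<exists>p\<in>X - {x1}. \<exists>q\<in>Y \<union> {x, s}. E p q"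
    by (rule biconnD[OF bi])
  then obtain p q where pq: "p \<in> X" "p \<noteq> x1" "q \<in> Y \<union> {x, s}" "E p q" by auto
  then have "q \<in> Y" using x1_only[of p] sym[of p q] by auto
  with pq sep show False unfolding separation_def by simp
qed

text \<open>A cut vertex \<open>t\<close> of \<open>V - {a}\<close> does not cut \<open>V\<close>,
  so \<open>a\<close> has neighbours on both sides of the cut. By \<open>unsplit\<close>, which says
  that \<open>X - {a}\<close> stays connected after any further deletion, one side contains what is
  left of \<open>X\<close>. The neighbour on the other side must then be \<open>x\<close> or
  \<open>s\<close>, and these remain linked to \<open>X\<close> by \<open>xn\<close>,
  \<open>sn\<close> and the clique \<open>Y\<close>.\<close>

lemma biconn_delete:
  assumes bi: "biconn V" and sep: "separation V x s X Y" and a: "a \<in> X"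
    and unsplit: "\<And>t P Q. t \<notin> P \<union> Q \<Longrightarrow> X - {a} - {t} \<subseteq> P \<union> Q \<Longrightarrow> \<forall>p\<in>P. \<forall>q\<in>Q. \<not> E p q \<Longrightarrow>
        X - {a} - {t} \<subseteq> P \<or> X - {a} - {t} \<subseteq> Q"
    and Y: "\<And>y y'. y \<in> Y \<Longrightarrow> y' \<in> Y \<Longrightarrow> y \<noteq> y' \<Longrightarrow> E y y'"
    and xn: "xn \<in> X" "xn \<noteq> a" "E x xn" and sn: "sn \<in> X" "sn \<noteq> a" "E s sn" and "xn \<noteq> sn"
  shows "biconn (V - {a})"
proof -
  have sV: "x \<in> V" "s \<in> V" "x \<noteq> s" "X \<inter> Y = {}" "X \<union> Y = V - {x, s}"
    using sep unfolding separation_def by auto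
  have XY: "\<not> E p q" if "p \<in> X" "q \<in> Y" for p q
    using sep that unfolding separation_def by simp
  have V: "V = X \<union> Y \<union> {x, s}" using sV by auto
  have notin: "x \<notin> X" "s \<notin> X" "x \<notin> Y" "s \<notin> Y" using sV by auto
  obtain yx ys where y: "yx \<in> Y" "E x yx" "ys \<in> Y" "E s ys"
    using separation_nbr[OF bi sep] separation_nbr[OF bi separation_swap_cut[OF sep]] by auto
  \<comment> \<open>Here \<open>P\<close> is the part that contains the rest of \<open>X\<close>; it
    is applied with \<open>P\<close> and \<open>Q\<close> in either order.\<close>
  have side: False
    if P: "t \<in> V - {a}" "P \<inter> Q = {}" "P \<union> Q = V - {a} - {t}" "X - {a} - {t} \<subseteq> P"
      and no: "\<And>p q. p \<in> P \<Longrightarrow> q \<in> Q \<Longrightarrow> \<not> E p q" and q: "q \<in> Q" "E a q"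
    for t P Q q
  proof -
    have no': "\<not> E q p" if "p \<in> P" "q \<in> Q" for p q using no[OF that] sym by blast
    have cover: "z \<in> P \<or> z \<in> Q" if "z \<in> V" "z \<noteq> a" "z \<noteq> t" for z using P that by blast
    have disj: "z \<notin> P" if "z \<in> Q" for z using P that by blast
    have tn: "t \<notin> P" "t \<notin> Q" using P by blast+
    have inP: "z \<in> P" if "z \<in> X" "z \<noteq> a" "z \<noteq> t" for z using P that by blast
    have "q \<noteq> a" "q \<in> V" "q \<noteq> t" using P q by blast+
    have "q \<notin> Y" using XY[OF a] q by blast
    have "q \<notin> X" using inP disj q \<open>q \<noteq> a\<close> \<open>q \<noteq> t\<close> by blast
    have ax: "x \<noteq> a" "s \<noteq> a" using notin a by auto
    have ya: "yx \<noteq> a" "ys \<noteq> a" using y(1,3) a sV(4) by auto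
    have mem: "xn \<in> V" "sn \<in> V" "yx \<in> V" "ys \<in> V" using V xn sn y by auto
    have neq: "s \<noteq> xn" "x \<noteq> sn" "yx \<noteq> xn" "yx \<noteq> sn" "ys \<noteq> xn" "ys \<noteq> sn"
      using notin xn(1) sn(1) y sV(4) by auto
    have Yxs: "yx = ys \<or> E yx ys" "yx = ys \<or> E ys yx" using Y y by blast+
    consider "q = x" | "q = s" using \<open>q \<in> V\<close> V \<open>q \<notin> X\<close> \<open>q \<notin> Y\<close> by blast
    then show False
    proof cases
      case 1
      \<comment> \<open>Only the deletion of \<open>xn\<close> can keep \<open>x\<close> out of
        \<open>P\<close>. Then \<open>sn\<close> survives, and the route \<open>sn\<close>,
        \<open>s\<close>, \<open>ys\<close>, \<open>yx\<close> leads from \<open>P\<close> into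
        \<open>Q\<close>.\<close>
      have "xn = t" using no'[of xn x] inP[of xn] xn q(1) 1 by blast
      then have "sn \<in> P" using inP sn \<open>xn \<noteq> sn\<close> by blast
      then have "s \<in> P" using cover[of s] no[of sn s] sym[OF sn(3)] sV(2) ax neq \<open>xn = t\<close> by blast
      then have "ys \<in> P" using cover[of ys] no[of s ys] y mem ya neq \<open>xn = t\<close> by blast
      moreover have "yx \<in> Q"
        using cover[of yx] no'[of yx x] y mem ya neq \<open>xn = t\<close> q(1) 1 by blast
      ultimately show False using no[of ys yx] Yxs disj by blast
    next
      case 2
      have "sn = t" using no'[of sn s] inP[of sn] sn q(1) 2 by blast
      then have "xn \<in> P" using inP xn \<open>xn \<noteq> sn\<close> by blast
      then have "x \<in> P" using cover[of x] no[of xn x] sym[OF xn(3)] sV(1) ax neq \<open>sn = t\<close> by blast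
      then have "yx \<in> P" using cover[of yx] no[of x yx] y mem ya neq \<open>sn = t\<close> by blast
      moreover have "ys \<in> Q"
        using cover[of ys] no'[of ys s] y mem ya neq \<open>sn = t\<close> q(1) 2 by blast
      ultimately show False using no[of yx ys] Yxs disj by blast
    qed
  qed
  show ?thesis
    unfolding biconn_def
  proof (intro ballI allI impI, rule ccontr)
    fix t P Q
    assume t: "t \<in> V - {a}" and PQ: "P \<noteq> {}" "Q \<noteq> {}" "P \<inter> Q = {}" "P \<union> Q = V - {a} - {t}"
      and "\<not> (\<exists>x\<in>P. \<exists>y\<in>Q. E x y)"
    then have no: "\<not> E p q" if "p \<in> P" "q \<in> Q" for p q using that by blast
    then have no': "\<not> E q p" if "p \<in> P" "q \<in> Q" for p q using that sym by blast
    have aV: "a \<in> V" using V a by blast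
    \<comment> \<open>If \<open>a\<close> had no neighbour in \<open>P\<close>, then
      \<open>t\<close> would separate \<open>P\<close> from \<open>insert a Q\<close> in
      \<open>V\<close> itself; likewise for \<open>Q\<close>.\<close>
    have "\<exists>p\<in>P. \<exists>q\<in>insert a Q. E p q"
      using t PQ aV by (intro biconnD[OF bi, of t]) auto
    then obtain p where p: "p \<in> P" "E a p" using no sym by blast
    have "\<exists>p\<in>Q. \<exists>q\<in>insert a P. E p q"
      using t PQ aV by (intro biconnD[OF bi, of t]) auto
    then obtain q where q: "q \<in> Q" "E a q" using no' sym by blast
    have "t \<notin> P \<union> Q" "X - {a} - {t} \<subseteq> P \<union> Q" using PQ V by auto
    with no have "X - {a} - {t} \<subseteq> P \<or> X - {a} - {t} \<subseteq> Q" by (intro unsplit) auto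
    then show False
    proof
      assume "X - {a} - {t} \<subseteq> P"
      then show False using side[OF t PQ(3,4)] no q by blast
    next
      assume "X - {a} - {t} \<subseteq> Q"
      then show False using side[of t Q P p] t PQ(3,4) no' p by (simp add: Int_commute Un_commute)
    qed
  qed
qed

section \<open>Choosing the vertex to delete\<close>

lemma card_nbrs_ge:
  assumes "finite V" "Z \<subseteq> V" "a \<notin> Z" "\<And>y z. y \<in> Z \<Longrightarrow> z \<in> Z \<Longrightarrow> \<not> E a y \<Longrightarrow> \<not> E a z \<Longrightarrow> y = z"
  shows "card Z \<le> Suc (card (nbrs V a))"
proof (cases "\<exists>y\<in>Z. \<not> E a y")
  case True
  then obtain y where "y \<in> Z" "\<not> E a y" by blast
  then have "Z \<subseteq> insert y (nbrs V a)" using assms unfolding nbrs_def by blast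
  moreover have fin: "finite (nbrs V a)" using assms unfolding nbrs_def by simp
  ultimately have "card Z \<le> card (insert y (nbrs V a))" by (intro card_mono) auto
  then show ?thesis using card_insert_le_m1[of "Suc (card (nbrs V a))"] fin
    by (simp add: card_insert_if split: if_splits)
next
  case False
  then have "Z \<subseteq> nbrs V a" using assms unfolding nbrs_def by blast
  moreover have "finite (nbrs V a)" using assms unfolding nbrs_def by simp
  ultimately have "card Z \<le> card (nbrs V a)" by (rule card_mono[rotated])
  then show ?thesis by simp
qed

text \<open>The candidate is a vertex of the larger side that avoids two disjoint edges attaching
  the pair. Six vertices outside the pair leave three situations: \<open>X\<close> has at least 5
  vertices, or 4 with at least 2 in \<open>Y\<close>, or both sides have 3. Only in the last can the
  candidate have degree 2, and then a vertex of \<open>Y\<close> takes its place.\<close>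

lemma ex_deletable_of_separation:
  assumes fin: "finite V" and bi: "biconn V" and sf: "sparse_free V" and sep: "separation V x s X Y"
    and le: "card Y \<le> card X" and six: "6 \<le> card X + card Y"
  shows "\<exists>a\<in>V. 3 \<le> card (nbrs V a) \<and> biconn (V - {a})"
proof -
  have sV: "x \<in> V" "s \<in> V" "x \<noteq> s" "X \<inter> Y = {}" "X \<union> Y = V - {x, s}" "Y \<noteq> {}"
    using sep unfolding separation_def by auto
  have XY: "\<not> E p q" if "p \<in> X" "q \<in> Y" for p q
    using sep that unfolding separation_def by simp
  have YX: "\<not> E q p" if "p \<in> X" "q \<in> Y" for p q using XY[OF that] sym by blast
  have sub: "X \<subseteq> V" "Y \<subseteq> V" using sV by auto
  have finX: "finite X" "finite Y" using fin sub finite_subset by auto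
  have neqXY: "p \<noteq> q" if "p \<in> X" "q \<in> Y" for p q using that sV by blast
  \<comment> \<open>Two vertices \<open>z\<close>, \<open>z'\<close> of the opposite side have no
    edge to \<open>y\<close> or \<open>y'\<close>; if \<open>y\<close> and \<open>y'\<close> were
    non-adjacent, the four would span at most the edge \<open>zz'\<close>.\<close>
  have clique: "E y y'" if "y \<in> Y'" "y' \<in> Y'" "y \<noteq> y'" "2 \<le> card X'" and XY': "X' = X \<and> Y' = Y \<or> X' = Y \<and> Y' = X"
    for y y' X' Y'
  proof -
    have "finite X'" using XY' finX by blast
    then obtain z z' where z: "z \<in> X'" "z' \<in> X'" "z \<noteq> z'"
      using \<open>2 \<le> card X'\<close> by (metis One_nat_def card_le_Suc0_iff_eq not_less_eq_eq numeral_2_eq_2)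
    have "{z, z', y, y'} \<subseteq> V" "distinct [z, z', y, y']" using z that XY' sub neqXY by auto
    moreover have "\<not> E z y" "\<not> E z y'" "\<not> E z' y" "\<not> E z' y'"
      using z that XY' XY YX by blast+
    ultimately show ?thesis using sparse_freeD[OF sf] by blast
  qed
  have cX: "3 \<le> card X" using le six by simp
  have Ycl: "E y y'" if "y \<in> Y" "y' \<in> Y" "y \<noteq> y'" for y y'
    using clique[of y Y y' X] that cX by simp
  obtain y0 where y0: "y0 \<in> Y" using sV by auto
  \<comment> \<open>All of \<open>X\<close> consists of non-neighbours of \<open>y0\<close>, so
    non-adjacency in \<open>X\<close> is a matching.\<close>
  have Xm: "E p r" if "p \<in> X" "q \<in> X" "r \<in> X" "distinct [p, q, r]" "\<not> E p q" for p q r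
    using that y0 sub neqXY[of _ y0] YX[of _ y0]
    by (intro nonneighbours_matching[OF sf, of y0 p q r]) auto
  have biconn: "biconn (V - {a})"
    if "a \<in> X" "x1 \<in> X" "x1 \<noteq> a" "E x x1" "s1 \<in> X" "s1 \<noteq> a" "E s s1" "x1 \<noteq> s1"
      and big: "5 \<le> card X \<or> 2 \<le> card Y" for a x1 s1
  proof (rule biconn_delete[OF bi sep _ _ Ycl, where xn = x1 and sn = s1])
    fix t P Q
    assume PQ: "t \<notin> P \<union> Q" "X - {a} - {t} \<subseteq> P \<union> Q" "\<forall>p\<in>P. \<forall>q\<in>Q. \<not> E p q"
    show "X - {a} - {t} \<subseteq> P \<or> X - {a} - {t} \<subseteq> Q"
    proof (rule ccontr)
      assume "\<not> ?thesis"
      then obtain p q where pq: "p \<in> X" "p \<in> P" "p \<notin> Q" "q \<in> X" "q \<in> Q" "q \<notin> P"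
          "p \<noteq> a" "q \<noteq> a" "p \<noteq> t" "q \<noteq> t"
        using PQ by blast
      then have "\<not> E p q" "\<not> E q p" "p \<noteq> q" using PQ sym by blast+
      from big show False
      proof
        assume "2 \<le> card Y"
        then show False using clique[of p X q Y] pq \<open>\<not> E p q\<close> \<open>p \<noteq> q\<close> by simp
      next
        assume "5 \<le> card X"
        \<comment> \<open>Since \<open>p\<close> and \<open>q\<close> are matched by non-adjacency,
          a fifth vertex \<open>r\<close> of \<open>X\<close> is adjacent to both and joins the two
          parts.\<close>
        have "card {a, t, p, q} \<le> 4" by (simp add: card_insert_if)
        then have "\<not> X \<subseteq> {a, t, p, q}"
          using \<open>5 \<le> card X\<close> card_mono[of "{a, t, p, q}" X] by auto
        then obtain r where r: "r \<in> X" "r \<noteq> a" "r \<noteq> t" "r \<noteq> p" "r \<noteq> q" by blast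
        then have "E p r" "E q r"
          using Xm[of p q r] Xm[of q p r] pq \<open>\<not> E p q\<close> \<open>\<not> E q p\<close> \<open>p \<noteq> q\<close> by auto
        moreover have "r \<in> P \<or> r \<in> Q" using r PQ by blast
        ultimately show False using PQ pq sym by blast
      qed
    qed
  qed (use that in auto)
  obtain x1 s1 where x1: "x1 \<in> X" "s1 \<in> X" "x1 \<noteq> s1" "E x x1" "E s s1"
    using separation_matched[OF bi sep finX(1)] cX by auto
  have "card (X - {x1, s1}) \<noteq> 0"
    using cX x1 by (simp add: card_Diff_subset)
  then have "X - {x1, s1} \<noteq> {}" by (metis card.empty)
  then obtain a where a: "a \<in> X" "a \<noteq> x1" "a \<noteq> s1" by blast
  have aV: "a \<in> V" using a sub by auto
  show ?thesis
  proof (cases "4 \<le> card X")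
    case True
    \<comment> \<open>At most one other vertex of \<open>X\<close> is not adjacent to
      \<open>a\<close>. This gives degree 3 once \<open>X\<close> has 5 vertices; with 4 of them
      \<open>Y\<close> has at least 2, so that \<open>X\<close> is a clique.\<close>
    have "card (X - {a}) \<le> Suc (card (nbrs V a))"
      using a Xm[of a] by (intro card_nbrs_ge[OF fin]) (use sub in auto)
    moreover have "5 \<le> card X \<Longrightarrow> ?thesis"
      using calculation biconn[of a x1 s1] x1 a aV
      by (intro bexI[of _ a]) (auto simp: card_Diff_singleton)
    moreover have ?thesis if "2 \<le> card Y"
    proof -
      have "X - {a} \<subseteq> nbrs V a" using clique[of a X _ Y] a that sub by (auto simp: nbrs_def)
      then have "card (X - {a}) \<le> card (nbrs V a)"
        using fin by (intro card_mono) (auto simp: nbrs_def)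
      then show ?thesis using True biconn[of a x1 s1] x1 a aV that
        by (intro bexI[of _ a]) (auto simp: card_Diff_singleton)
    qed
    ultimately show ?thesis using six by linarith
  next
    case False
    \<comment> \<open>Both sides are triangles, so a vertex has two neighbours on its own side and
      needs a third in the separating pair.\<close>
    then have card3: "card X = 3" "card Y = 3" using le six by auto
    have deg: "3 \<le> card (nbrs V c)" if c: "c \<in> Z" "E c x \<or> E c s" "Z = X \<or> Z = Y" for c Z
    proof -
      obtain w where w: "w \<in> {x, s}" "E c w" using c by auto
      have "2 \<le> card X" "2 \<le> card Y" using card3 by auto
      then have "insert w (Z - {c}) \<subseteq> nbrs V c"
        using c w sub sV(1,2) clique[of c Z _ Y] clique[of c Z _ X] by (auto simp: nbrs_def)
      then have "card (insert w (Z - {c})) \<le> card (nbrs V c)"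
        using fin by (intro card_mono) (auto simp: nbrs_def)
      moreover have "w \<notin> Z" "finite Z" "card Z = 3" using c w sV(5) finX card3 by auto
      ultimately show ?thesis using c by (simp add: card_Diff_singleton)
    qed
    show ?thesis
    proof (cases "E a x \<or> E a s")
      case True
      then show ?thesis using deg[of a X] a biconn[of a x1 s1] x1 aV card3
        by (intro bexI[of _ a]) auto
    next
      case no: False
      obtain x2 s2 where x2: "x2 \<in> Y" "s2 \<in> Y" "x2 \<noteq> s2" "E x x2" "E s s2"
        using separation_matched[OF bi separation_swap_sides[OF sep] finX(2)] card3 by auto
      have "card (Y - {x2, s2}) \<noteq> 0"
        using card3 x2 by (simp add: card_Diff_subset)
      then have "Y - {x2, s2} \<noteq> {}" by (metis card.empty)
      then obtain b where b: "b \<in> Y" "b \<noteq> x2" "b \<noteq> s2" by blast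
      \<comment> \<open>Since \<open>a\<close> is adjacent to none of \<open>x\<close>,
        \<open>s\<close>, \<open>b\<close>, the edge \<open>xs\<close> alone would be too little:
        \<open>b\<close> must have a neighbour in the pair.\<close>
      have "{x, s, a, b} \<subseteq> V" "distinct [x, s, a, b]"
        using sV a b sub neqXY[of a b] by auto
      from sparse_freeD[OF sf this] have "E b x \<or> E b s"
        using no XY[of a b] a b sym by blast
      then have "3 \<le> card (nbrs V b)" using deg[of b Y] b by auto
      moreover have Xcl: "E y y'" if "y \<in> X" "y' \<in> X" "y \<noteq> y'" for y y'
        using clique[of y X y' Y] that card3 by simp
      have "biconn (V - {b})"
      proof (rule biconn_delete[OF bi separation_swap_sides[OF sep] b(1) _ Xcl, where xn = x2 and sn = s2])
        fix t P Q
        assume PQ: "t \<notin> P \<union> Q" "Y - {b} - {t} \<subseteq> P \<union> Q" "\<forall>p\<in>P. \<forall>q\<in>Q. \<not> E p q"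
        show "Y - {b} - {t} \<subseteq> P \<or> Y - {b} - {t} \<subseteq> Q"
        proof (rule ccontr)
          assume "\<not> ?thesis"
          then obtain p q where "p \<in> Y" "p \<in> P" "q \<in> Y" "q \<in> Q" "q \<notin> P"
            using PQ by blast
          then show False using PQ(3) Ycl[of p q] by blast
        qed
      qed (use x2 b in auto)
      ultimately show ?thesis using b sub by auto
    qed
  qed
qed

end

section \<open>Graphs of order 7\<close>

text \<open>
  A certificate is a decision tree over the pairs of labels \<open>0, \<dots>, 6\<close>, whose first branch
  assumes an edge and whose second branch assumes a non-edge. Its leaves exhibit a pancyclic edge
  (\<open>Paths u v ps\<close>, where \<open>ps\<close> lists only the interiors of the paths) or contradict one of the
  hypotheses. \<open>Es\<close> and \<open>Ns\<close> below collect the edges and non-edges assumed so far, and \<open>d\<close> is a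
  lower bound on all degrees.
\<close>

datatype certificate =
  Branch nat nat certificate certificate
| Paths nat nat "nat list list"
| Sparse nat nat nat nat
| Cut nat "nat list" "nat list"
| Low_Degree nat "nat list"

section \<open>Soundness of the decision trees\<close>

definition listed :: "(nat \<times> nat) list \<Rightarrow> nat \<Rightarrow> nat \<Rightarrow> bool" where
  "listed L i j \<longleftrightarrow> (i, j) \<in> set L \<or> (j, i) \<in> set L"

text \<open>Interiors of 1 to 5 vertices correspond to cycles of length 3 to 7. In
  \<open>Sparse\<close> the pair \<open>a b\<close> is left free. In \<open>Low_Degree\<close> the
  label \<open>i\<close> and the list \<open>js\<close> leave at most \<open>6 - length js\<close>
  possible neighbours, fewer than \<open>d\<close>. Labels in \<open>Branch\<close> need no range
  test, since a case split is sound for any two values of the labelling.\<close>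

fun check :: "nat \<Rightarrow> (nat \<times> nat) list \<Rightarrow> (nat \<times> nat) list \<Rightarrow> certificate \<Rightarrow> bool" where
  "check d Es Ns (Branch i j s t) \<longleftrightarrow> check d ((i, j) # Es) Ns s \<and> check d Es ((i, j) # Ns) t"
| "check d Es Ns (Paths u v ps) \<longleftrightarrow> listed Es u v \<and> map length ps = [1, 2, 3, 4, 5] \<and>
     (\<forall>p \<in> set ps. list_all (\<lambda>i. i < 7) (u # p @ [v]) \<and> distinct (u # p @ [v]) \<and>
        successively (listed Es) (u # p @ [v]))"
| "check d Es Ns (Sparse a b c e) \<longleftrightarrow> list_all (\<lambda>i. i < 7) [a, b, c, e] \<and> distinct [a, b, c, e] \<and>
     listed Ns a c \<and> listed Ns a e \<and> listed Ns b c \<and> listed Ns b e \<and> listed Ns c e"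
| "check d Es Ns (Cut s xs ys) \<longleftrightarrow> xs \<noteq> [] \<and> ys \<noteq> [] \<and> list_all (\<lambda>i. i < 7) (s # xs @ ys) \<and>
     distinct (s # xs @ ys) \<and> length (s # xs @ ys) = 7 \<and>
     list_all (\<lambda>x. list_all (listed Ns x) ys) xs"
| "check d Es Ns (Low_Degree i js) \<longleftrightarrow> list_all (\<lambda>i. i < 7) (i # js) \<and> distinct (i # js) \<and>
     7 \<le> length js + d \<and> list_all (listed Ns i) js"

context adjacency begin

lemma check_sound:
  assumes f: "inj_on f {..<7}" "f ` {..<7} = V" and sf: "sparse_free V" and bi: "biconn V"
    and deg: "\<And>v. v \<in> V \<Longrightarrow> d \<le> card (nbrs V v)"
  shows "check d Es Ns c \<Longrightarrow> \<forall>(i, j) \<in> set Es. E (f i) (f j) \<Longrightarrow> \<forall>(i, j) \<in> set Ns. \<not> E (f i) (f j) \<Longrightarrow>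
    \<exists>u v. pancyclic_pair V u v"
proof (induction c arbitrary: Es Ns)
  case (Branch i j s t)
  then show ?case by (cases "E (f i) (f j)") auto
next
  case (Paths u v ps)
  have E: "E (f i) (f j)" if "listed Es i j" for i j
    using that Paths(2) sym unfolding listed_def by blast
  have cardV: "card V = 7" using f card_image[of f "{..<7}"] by simp
  have "\<exists>p. upath (f u) (f v) p \<and> set p \<subseteq> V \<and> length p = k" if "3 \<le> k" "k \<le> 7" for k
  proof -
    \<comment> \<open>A path on \<open>k\<close> vertices has \<open>k - 2\<close> inner
      ones.\<close>
    have "k - 2 \<in> set (map length ps)"
      using Paths(1) that by (auto simp: numeral_eq_Suc)
    then obtain p where p: "p \<in> set ps" "length p = k - 2" by auto
    let ?q = "u # p @ [v]"
    have q: "set ?q \<subseteq> {..<7}" "distinct ?q" "successively (listed Es) ?q"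
      using Paths(1) p by (auto simp: list_all_iff)
    have "distinct (map f ?q)"
      using q f(1) by (simp only: distinct_map) (blast intro: inj_on_subset)
    moreover have "successively E (map f ?q)"
      using q(3) E unfolding successively_map by (rule successively_mono) blast
    ultimately have "upath (f u) (f v) (map f ?q)" unfolding upath_def by simp
    moreover have "set (map f ?q) \<subseteq> V" using q(1) f(2) by auto
    moreover have "length (map f ?q) = k" using p that by simp
    ultimately show ?thesis by blast
  qed
  moreover have "E (f u) (f v)" using Paths(1) E by simp
  ultimately show ?case unfolding pancyclic_pair_def cardV by blast
next
  case (Sparse a b c e)
  have N: "\<not> E (f i) (f j)" if "listed Ns i j" for i j
    using that Sparse(3) sym unfolding listed_def by blast
  have *: "set [a, b, c, e] \<subseteq> {..<7}" "distinct [a, b, c, e]" using Sparse(1) by auto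
  then have "distinct (map f [a, b, c, e])"
    using f(1) by (simp only: distinct_map) (blast intro: inj_on_subset)
  moreover have "set (map f [a, b, c, e]) \<subseteq> V" using * f(2) by auto
  ultimately have "E (f a) (f c) \<or> E (f a) (f e) \<or> E (f b) (f c) \<or> E (f b) (f e) \<or> E (f c) (f e)"
    by (intro sparse_freeD[OF sf]) auto
  then show ?case using Sparse(1) N by auto
next
  case (Cut s xs ys)
  have N: "\<not> E (f i) (f j)" if "listed Ns i j" for i j
    using that Cut(3) sym unfolding listed_def by blast
  let ?q = "s # xs @ ys"
  have q: "set ?q \<subseteq> {..<7}" "distinct ?q" "length ?q = 7" using Cut(1) by (auto simp: list_all_iff)
  \<comment> \<open>Seven distinct labels below 7 are all the labels, so the two lists really
    partition what remains after removing \<open>s\<close>.\<close>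
  then have "set ?q = {..<7}" by (intro card_subset_eq) (auto simp: distinct_card[OF q(2)] simp del: set_simps)
  then have "set (map f ?q) = V" using f(2) by (simp only: set_map)
  moreover have "distinct (map f ?q)"
    using q f(1) by (simp only: distinct_map) (blast intro: inj_on_subset)
  ultimately have "\<exists>x\<in>f ` set xs. \<exists>y\<in>f ` set ys. E x y"
    using Cut(1) by (intro biconnD[OF bi, of "f s"]) auto
  then show ?case using Cut(1) N by (auto simp: list_all_iff)
next
  case (Low_Degree i js)
  have N: "\<not> E (f i) (f j)" if "listed Ns i j" for i j
    using that Low_Degree(3) sym unfolding listed_def by blast
  have q: "set (i # js) \<subseteq> {..<7}" "distinct (i # js)" using Low_Degree(1) by (auto simp: list_all_iff)
  then have dj: "distinct (map f (i # js))"
    using f(1) by (simp only: distinct_map) (blast intro: inj_on_subset)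
  have sub: "set (map f (i # js)) \<subseteq> V" using q(1) f(2) by auto
  have fin: "finite V" using f(2) by (metis finite_imageI finite_lessThan)
  have cardV: "card V = 7" using f card_image[of f "{..<7}"] by simp
  have "nbrs V (f i) \<subseteq> V - set (map f (i # js))"
    using Low_Degree(1) N irrefl by (auto simp: nbrs_def list_all_iff)
  then have "card (nbrs V (f i)) \<le> card (V - set (map f (i # js)))"
    using fin by (intro card_mono) auto
  also have "\<dots> = 7 - length (i # js)"
    using sub cardV distinct_card[OF dj] by (subst card_Diff_subset) auto
  finally have "card (nbrs V (f i)) \<le> 6 - length js" by simp
  moreover have "d \<le> card (nbrs V (f i))" using deg[of "f i"] sub by auto
  moreover have "7 \<le> length js + d" using Low_Degree(1) by simp
  moreover have "length js \<le> 6"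
    using card_mono[OF fin sub] cardV distinct_card[OF dj] by simp
  ultimately show ?case by linarith
qed

end

text \<open>
  The trees were found by computer search. Vertex \<open>0\<close> has minimum degree and its neighbours come
  next in the labelling.
\<close>

definition certificate_le2 :: certificate where
 "certificate_le2 =
  Branch 0 2 (Branch 0 1 (Branch 5 6 (Branch 3 4 (Branch 4 6 (Branch 3 5 (Branch 2 5 (Branch 1 3
   (Branch 1 4 (Branch 2 3 (Paths 1 3 [[4],[0,2],[0,2,5],[4,6,5,2],[0,2,5,6,4]]) (Branch 3 6 (Paths
   1 3 [[4],[4,6],[0,2,5],[0,2,5,6],[0,2,5,6,4]]) (Branch 2 6 (Paths 3 4
   [[1],[5,6],[5,2,6],[1,0,2,6],[1,0,2,5,6]]) (Sparse 0 2 3 6)))) (Branch 1 5 (Branch 2 6 (Paths 1 5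
   [[3],[0,2],[0,2,6],[3,4,6,2],[0,2,6,4,3]]) (Branch 3 6 (Paths 1 3
   [[5],[5,6],[0,2,5],[0,2,5,6],[0,2,5,6,4]]) (Branch 2 3 (Branch 1 6 (Paths 3 5
   [[2],[1,6],[1,0,2],[2,0,1,6],[4,6,1,0,2]]) (Branch 1 2 (Paths 1 3
   [[5],[2,5],[0,2,5],[2,5,6,4],[0,2,5,6,4]]) (Branch 2 4 (Paths 3 5
   [[1],[4,6],[1,0,2],[4,2,0,1],[1,0,2,4,6]]) (Sparse 4 6 1 2)))) (Sparse 0 2 3 6)))) (Branch 4 5
   (Branch 1 2 (Paths 3 4 [[5],[5,6],[1,2,5],[1,0,2,5],[1,0,2,5,6]]) (Branch 1 6 (Paths 3 4
   [[5],[1,6],[1,6,5],[1,0,2,5],[1,0,2,5,6]]) (Branch 2 6 (Paths 2 5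
   [[6],[6,4],[0,1,3],[0,1,3,4],[0,1,3,4,6]]) (Branch 2 4 (Paths 2 4
   [[5],[5,3],[0,1,3],[0,1,3,5],[0,1,3,5,6]]) (Sparse 4 6 1 2))))) (Sparse 0 1 4 5)))) (Branch 1 6
   (Branch 2 4 (Branch 1 4 (Paths 4 6 [[1],[3,5],[2,0,1],[1,0,2,5],[3,5,2,0,1]]) (Branch 4 5 (Paths
   2 4 [[5],[5,3],[0,1,6],[0,1,6,5],[0,1,6,5,3]]) (Branch 1 5 (Paths 5 6
   [[1],[2,4],[2,0,1],[1,0,2,4],[3,4,2,0,1]]) (Sparse 0 1 4 5)))) (Branch 1 5 (Branch 2 3 (Paths 1 5
   [[6],[0,2],[0,2,3],[6,4,3,2],[0,2,3,4,6]]) (Branch 1 4 (Paths 4 6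
   [[1],[1,5],[3,5,1],[1,0,2,5],[3,5,2,0,1]]) (Branch 1 2 (Paths 1 6
   [[5],[2,5],[0,2,5],[2,5,3,4],[0,2,5,3,4]]) (Sparse 3 4 1 2)))) (Branch 4 5 (Branch 1 4 (Paths 1 6
   [[4],[4,5],[0,2,5],[0,2,5,4],[0,2,5,3,4]]) (Branch 2 3 (Paths 2 3
   [[5],[5,4],[5,6,4],[0,1,6,4],[0,1,6,5,4]]) (Branch 1 2 (Paths 4 6
   [[5],[3,5],[5,2,1],[5,2,0,1],[3,5,2,0,1]]) (Sparse 3 4 1 2)))) (Branch 1 4 (Branch 2 6 (Paths 1 6
   [[4],[0,2],[0,2,5],[4,3,5,2],[0,2,5,3,4]]) (Branch 2 3 (Paths 3 5
   [[2],[4,6],[4,1,6],[4,1,0,2],[4,6,1,0,2]]) (Branch 3 6 (Paths 1 4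
   [[6],[6,3],[6,5,3],[0,2,5,6],[0,2,5,6,3]]) (Sparse 0 2 3 6)))) (Sparse 0 1 4 5))))) (Branch 3 6
   (Branch 1 4 (Branch 1 2 (Paths 3 4 [[6],[5,6],[5,2,1],[5,2,0,1],[6,5,2,0,1]]) (Branch 2 6 (Paths
   2 5 [[6],[6,3],[6,4,3],[0,1,4,6],[0,1,4,3,6]]) (Branch 2 3 (Paths 2 3
   [[5],[5,6],[0,1,4],[0,1,4,6],[0,1,4,6,5]]) (Sparse 3 6 1 2)))) (Branch 1 5 (Branch 2 6 (Paths 2 6
   [[5],[5,3],[0,1,5],[0,1,5,3],[0,1,5,3,4]]) (Branch 2 3 (Paths 2 3
   [[5],[5,6],[0,1,5],[0,1,5,6],[0,1,5,6,4]]) (Branch 2 4 (Paths 3 4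
   [[6],[5,2],[6,5,2],[5,1,0,2],[6,5,1,0,2]]) (Cut 5 [0,1,2] [3,4,6])))) (Cut 2 [0,1] [3,4,5,6])))
   (Sparse 0 1 3 6)))) (Branch 2 4 (Branch 3 6 (Branch 1 6 (Branch 2 3 (Paths 2 4
   [[3],[3,6],[0,1,6],[0,1,6,3],[0,1,6,5,3]]) (Branch 1 3 (Paths 1 3
   [[6],[6,4],[0,2,4],[0,2,4,6],[0,2,4,6,5]]) (Branch 1 5 (Paths 1 6
   [[5],[5,3],[0,2,4],[0,2,4,3],[0,2,4,3,5]]) (Branch 1 2 (Paths 3 4
   [[6],[5,6],[6,1,2],[6,1,0,2],[5,6,1,0,2]]) (Sparse 3 5 1 2))))) (Branch 1 3 (Branch 2 6 (Paths 2
   4 [[6],[6,3],[0,1,3],[0,1,3,6],[0,1,3,5,6]]) (Branch 1 5 (Paths 1 3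
   [[5],[5,6],[0,2,4],[0,2,4,6],[0,2,4,6,5]]) (Branch 1 2 (Paths 4 6
   [[3],[3,5],[2,1,3],[2,0,1,3],[2,0,1,3,5]]) (Sparse 5 6 1 2)))) (Branch 1 5 (Branch 2 6 (Paths 2 6
   [[4],[4,3],[0,1,5],[0,1,5,3],[0,1,5,3,4]]) (Branch 2 3 (Paths 2 3
   [[4],[4,6],[0,1,5],[0,1,5,6],[0,1,5,6,4]]) (Branch 1 2 (Paths 3 4
   [[6],[5,6],[5,1,2],[5,1,0,2],[6,5,1,0,2]]) (Sparse 3 6 1 2)))) (Branch 1 4 (Branch 2 3 (Paths 2 3
   [[4],[4,6],[0,1,4],[0,1,4,6],[0,1,4,6,5]]) (Branch 2 6 (Paths 2 6
   [[4],[4,3],[0,1,4],[0,1,4,3],[0,1,4,3,5]]) (Cut 4 [0,1,2] [3,5,6]))) (Cut 2 [0,1] [3,4,5,6])))))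
   (Branch 1 3 (Branch 2 3 (Branch 1 5 (Paths 1 3 [[5],[0,2],[0,2,4],[5,6,4,2],[0,2,4,6,5]]) (Branch
   1 6 (Paths 3 4 [[2],[1,6],[1,0,2],[2,0,1,6],[5,6,1,0,2]]) (Branch 2 6 (Paths 4 6
   [[2],[3,2],[2,3,5],[3,1,0,2],[2,0,1,3,5]]) (Branch 1 2 (Paths 1 3
   [[2],[2,4],[0,2,4],[2,4,6,5],[0,2,4,6,5]]) (Sparse 5 6 1 2))))) (Branch 2 6 (Branch 4 5 (Paths 2
   4 [[6],[6,5],[0,1,3],[0,1,3,5],[0,1,3,5,6]]) (Branch 1 5 (Paths 3 5
   [[1],[4,6],[4,2,6],[1,0,2,6],[1,0,2,4,6]]) (Branch 1 4 (Paths 1 4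
   [[3],[0,2],[0,2,6],[3,5,6,2],[0,2,6,5,3]]) (Sparse 0 1 4 5)))) (Sparse 0 2 3 6))) (Branch 1 6
   (Branch 2 6 (Branch 1 2 (Paths 1 6 [[2],[2,4],[0,2,4],[2,4,3,5],[0,2,4,3,5]]) (Branch 2 3 (Paths
   3 4 [[2],[2,6],[5,6,2],[2,0,1,6],[5,6,1,0,2]]) (Branch 1 5 (Paths 1 6
   [[5],[0,2],[0,2,4],[5,3,4,2],[0,2,4,3,5]]) (Sparse 3 5 1 2)))) (Branch 2 3 (Branch 1 4 (Paths 1 4
   [[6],[0,2],[0,2,3],[6,5,3,2],[0,2,3,5,6]]) (Branch 4 5 (Paths 2 3
   [[4],[4,5],[4,6,5],[0,1,6,4],[0,1,6,5,4]]) (Branch 1 5 (Paths 3 4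
   [[2],[5,6],[5,1,6],[5,1,0,2],[5,6,1,0,2]]) (Sparse 0 1 4 5)))) (Sparse 0 2 3 6))) (Sparse 0 1 3
   6)))) (Branch 4 5 (Branch 2 3 (Branch 1 4 (Branch 1 2 (Paths 3 5
   [[4],[4,6],[2,1,4],[2,0,1,4],[2,0,1,4,6]]) (Branch 2 6 (Paths 3 5
   [[4],[2,6],[2,6,4],[2,0,1,4],[2,0,1,4,6]]) (Branch 1 5 (Paths 1 4
   [[5],[5,3],[0,2,3],[0,2,3,5],[0,2,3,5,6]]) (Branch 1 6 (Paths 1 4
   [[6],[6,5],[0,2,3],[0,2,3,5],[0,2,3,5,6]]) (Sparse 5 6 1 2))))) (Branch 1 2 (Branch 1 5 (Paths 3
   4 [[5],[5,6],[2,1,5],[2,0,1,5],[2,0,1,5,6]]) (Branch 1 6 (Paths 3 4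
   [[5],[5,6],[2,1,6],[2,0,1,6],[2,0,1,6,5]]) (Branch 1 3 (Branch 2 6 (Paths 3 4
   [[5],[2,6],[2,6,5],[1,0,2,6],[1,0,2,6,5]]) (Cut 3 [0,1,2] [4,5,6])) (Cut 2 [0,1] [3,4,5,6]))))
   (Branch 1 5 (Branch 2 6 (Paths 3 4 [[5],[2,6],[2,6,5],[2,0,1,5],[2,0,1,5,6]]) (Branch 1 6 (Paths
   1 5 [[6],[6,4],[0,2,3],[0,2,3,4],[0,2,3,4,6]]) (Sparse 4 6 1 2))) (Sparse 4 5 1 2)))) (Branch 2 6
   (Branch 1 5 (Branch 1 4 (Paths 1 4 [[5],[5,3],[0,2,6],[0,2,6,5],[0,2,6,5,3]]) (Branch 1 3 (Paths
   1 3 [[5],[5,4],[5,6,4],[0,2,6,4],[0,2,6,5,4]]) (Branch 1 2 (Paths 4 6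
   [[5],[3,5],[5,1,2],[5,1,0,2],[3,5,1,0,2]]) (Sparse 3 4 1 2)))) (Branch 1 2 (Branch 1 4 (Paths 5 6
   [[4],[3,4],[4,1,2],[4,1,0,2],[3,4,1,0,2]]) (Branch 1 3 (Paths 3 4
   [[5],[5,6],[1,2,6],[1,0,2,6],[1,0,2,6,5]]) (Cut 6 [0,1,2] [3,4,5]))) (Branch 1 3 (Branch 1 4
   (Paths 1 3 [[4],[4,5],[4,6,5],[0,2,6,4],[0,2,6,5,4]]) (Sparse 4 5 1 2)) (Sparse 3 5 1 2)))) (Cut
   1 [0,2] [3,4,5,6]))) (Sparse 0 2 4 5)))) (Branch 4 5 (Branch 3 6 (Branch 2 5 (Branch 1 5 (Branch
   2 4 (Paths 2 4 [[5],[5,6],[0,1,5],[0,1,5,6],[0,1,5,6,3]]) (Branch 2 3 (Paths 3 4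
   [[6],[2,5],[2,5,6],[2,0,1,5],[2,0,1,5,6]]) (Branch 1 4 (Paths 1 4
   [[5],[5,6],[0,2,5],[0,2,5,6],[0,2,5,6,3]]) (Branch 1 3 (Paths 3 4
   [[6],[1,5],[1,5,6],[1,0,2,5],[1,0,2,5,6]]) (Branch 1 6 (Paths 1 6
   [[5],[5,4],[0,2,5],[0,2,5,4],[0,2,5,4,3]]) (Branch 2 6 (Paths 2 6
   [[5],[5,4],[0,1,5],[0,1,5,4],[0,1,5,4,3]]) (Cut 5 [0,1,2] [3,4,6]))))))) (Branch 1 3 (Branch 1 4
   (Paths 1 3 [[4],[4,6],[4,5,6],[0,2,5,4],[0,2,5,6,4]]) (Branch 2 4 (Paths 2 4
   [[5],[5,6],[0,1,3],[0,1,3,6],[0,1,3,6,5]]) (Branch 1 6 (Paths 1 3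
   [[6],[6,4],[6,5,4],[0,2,5,4],[0,2,5,6,4]]) (Branch 2 6 (Paths 2 5
   [[6],[6,4],[6,3,4],[0,1,3,4],[0,1,3,4,6]]) (Branch 1 2 (Paths 3 4
   [[6],[6,5],[1,2,5],[1,0,2,5],[1,0,2,5,6]]) (Sparse 4 6 1 2)))))) (Sparse 0 1 3 5))) (Branch 2 3
   (Branch 1 5 (Branch 2 4 (Paths 2 3 [[4],[4,6],[4,5,6],[0,1,5,4],[0,1,5,6,4]]) (Branch 1 6 (Paths
   1 5 [[6],[6,4],[6,3,4],[0,2,3,4],[0,2,3,4,6]]) (Branch 1 2 (Paths 3 4
   [[6],[6,5],[2,1,5],[2,0,1,5],[2,0,1,5,6]]) (Branch 2 6 (Paths 2 3
   [[6],[6,4],[6,5,4],[0,1,5,4],[0,1,5,6,4]]) (Branch 1 4 (Paths 1 4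
   [[5],[5,6],[0,2,3],[0,2,3,6],[0,2,3,6,5]]) (Sparse 4 6 1 2)))))) (Branch 1 3 (Branch 1 4 (Paths 1
   4 [[3],[3,6],[0,2,3],[0,2,3,6],[0,2,3,6,5]]) (Branch 2 4 (Paths 2 4
   [[3],[3,6],[0,1,3],[0,1,3,6],[0,1,3,6,5]]) (Branch 2 6 (Paths 2 6
   [[3],[3,4],[0,1,3],[0,1,3,4],[0,1,3,4,5]]) (Branch 1 6 (Paths 1 6
   [[3],[3,4],[0,2,3],[0,2,3,4],[0,2,3,4,5]]) (Cut 3 [0,1,2] [4,5,6]))))) (Sparse 0 1 3 5))) (Sparse
   0 2 3 5))) (Sparse 5 6 0 3)) (Sparse 3 4 0 5))) (Branch 3 6 (Branch 4 5 (Branch 1 4 (Branch 2 4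
   (Branch 2 6 (Branch 1 3 (Paths 3 4 [[1],[6,5],[1,0,2],[6,2,0,1],[1,0,2,6,5]]) (Branch 3 5 (Paths
   3 4 [[5],[6,2],[5,6,2],[6,2,0,1],[5,6,2,0,1]]) (Branch 1 5 (Paths 4 5
   [[1],[3,6],[2,0,1],[1,0,2,6],[3,6,2,0,1]]) (Sparse 0 1 3 5)))) (Branch 3 5 (Branch 1 5 (Paths 1 5
   [[4],[4,3],[0,2,4],[0,2,4,3],[0,2,4,3,6]]) (Branch 1 3 (Paths 1 3
   [[4],[4,5],[0,2,4],[0,2,4,5],[0,2,4,5,6]]) (Branch 2 5 (Paths 2 5
   [[4],[4,3],[0,1,4],[0,1,4,3],[0,1,4,3,6]]) (Branch 1 6 (Paths 3 4
   [[5],[6,1],[5,6,1],[6,1,0,2],[5,6,1,0,2]]) (Branch 2 3 (Paths 2 3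
   [[4],[4,5],[0,1,4],[0,1,4,5],[0,1,4,5,6]]) (Cut 4 [0,1,2] [3,5,6])))))) (Branch 1 5 (Branch 2 3
   (Paths 1 4 [[5],[0,2],[0,2,3],[5,6,3,2],[0,2,3,6,5]]) (Branch 2 5 (Branch 1 6 (Paths 5 6
   [[1],[4,1],[1,4,3],[4,2,0,1],[1,0,2,4,3]]) (Branch 1 3 (Paths 1 4
   [[3],[0,2],[0,2,5],[3,6,5,2],[0,2,5,6,3]]) (Branch 1 2 (Paths 1 5
   [[4],[2,4],[0,2,4],[2,4,3,6],[0,2,4,3,6]]) (Sparse 3 6 1 2)))) (Sparse 0 2 3 5))) (Branch 1 3
   (Branch 2 5 (Paths 1 4 [[3],[0,2],[0,2,5],[3,6,5,2],[0,2,5,6,3]]) (Branch 1 6 (Paths 3 6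
   [[1],[4,1],[1,4,5],[4,2,0,1],[1,0,2,4,5]]) (Branch 1 2 (Paths 1 3
   [[4],[2,4],[0,2,4],[2,4,5,6],[0,2,4,5,6]]) (Sparse 5 6 1 2)))) (Sparse 0 1 3 5))))) (Branch 2 6
   (Branch 2 5 (Branch 3 5 (Paths 2 5 [[6],[6,3],[0,1,4],[0,1,4,3],[0,1,4,3,6]]) (Branch 1 5 (Paths
   1 5 [[4],[0,2],[0,2,6],[4,3,6,2],[0,2,6,3,4]]) (Branch 1 3 (Paths 3 4
   [[1],[6,5],[6,2,5],[6,2,0,1],[6,5,2,0,1]]) (Sparse 0 1 3 5)))) (Branch 2 3 (Branch 1 5 (Paths 3 6
   [[2],[4,5],[4,1,5],[2,0,1,5],[2,0,1,4,5]]) (Branch 1 3 (Paths 1 3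
   [[4],[0,2],[0,2,6],[4,5,6,2],[0,2,6,5,4]]) (Branch 3 5 (Paths 2 3
   [[6],[6,5],[0,1,4],[0,1,4,5],[0,1,4,5,6]]) (Sparse 0 1 3 5)))) (Branch 3 5 (Branch 1 3 (Paths 1 3
   [[4],[4,5],[0,2,6],[0,2,6,5],[0,2,6,5,4]]) (Branch 1 5 (Paths 1 4
   [[5],[5,3],[5,6,3],[0,2,6,3],[0,2,6,5,3]]) (Branch 1 2 (Paths 3 4
   [[5],[6,5],[6,2,1],[6,2,0,1],[5,6,2,0,1]]) (Sparse 3 5 1 2)))) (Sparse 0 2 3 5)))) (Sparse 0 2 4
   6))) (Branch 1 6 (Branch 2 4 (Branch 1 3 (Branch 3 5 (Paths 1 3
   [[6],[6,5],[0,2,4],[0,2,4,5],[0,2,4,5,6]]) (Branch 2 3 (Paths 1 3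
   [[6],[0,2],[0,2,4],[6,5,4,2],[0,2,4,5,6]]) (Branch 2 5 (Paths 3 6
   [[1],[4,5],[4,2,5],[4,2,0,1],[1,0,2,4,5]]) (Sparse 0 2 3 5)))) (Branch 3 5 (Branch 1 5 (Paths 1 5
   [[6],[6,3],[0,2,4],[0,2,4,3],[0,2,4,3,6]]) (Branch 1 2 (Paths 3 4
   [[5],[6,5],[6,1,2],[6,1,0,2],[5,6,1,0,2]]) (Branch 2 5 (Paths 2 4
   [[5],[5,3],[5,6,3],[0,1,6,3],[0,1,6,5,3]]) (Branch 2 3 (Paths 2 3
   [[4],[4,5],[0,1,6],[0,1,6,5],[0,1,6,5,4]]) (Sparse 3 5 1 2))))) (Branch 1 5 (Branch 2 3 (Paths 3
   4 [[2],[6,5],[6,1,5],[6,1,0,2],[6,5,1,0,2]]) (Branch 2 5 (Paths 1 5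
   [[6],[0,2],[0,2,4],[6,3,4,2],[0,2,4,3,6]]) (Sparse 0 2 3 5))) (Sparse 0 1 3 5)))) (Branch 2 6
   (Branch 1 2 (Branch 1 3 (Paths 1 3 [[6],[2,6],[0,2,6],[2,6,5,4],[0,2,6,5,4]]) (Branch 1 5 (Paths
   1 5 [[6],[2,6],[0,2,6],[2,6,3,4],[0,2,6,3,4]]) (Branch 2 3 (Paths 1 6
   [[2],[2,3],[0,2,3],[2,3,4,5],[0,2,3,4,5]]) (Branch 2 5 (Paths 1 6
   [[2],[2,5],[0,2,5],[2,5,4,3],[0,2,5,4,3]]) (Cut 6 [0,1,2] [3,4,5]))))) (Branch 1 3 (Branch 2 5
   (Paths 1 6 [[3],[0,2],[0,2,5],[3,4,5,2],[0,2,5,4,3]]) (Branch 1 5 (Branch 2 3 (Paths 1 6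
   [[5],[0,2],[0,2,3],[5,4,3,2],[0,2,3,4,5]]) (Branch 3 5 (Paths 1 3
   [[6],[6,5],[0,2,6],[0,2,6,5],[0,2,6,5,4]]) (Sparse 0 2 3 5))) (Sparse 4 5 1 2))) (Branch 2 3
   (Branch 1 5 (Paths 1 6 [[5],[0,2],[0,2,3],[5,4,3,2],[0,2,3,4,5]]) (Branch 3 5 (Paths 2 3
   [[6],[6,5],[0,1,6],[0,1,6,5],[0,1,6,5,4]]) (Sparse 0 1 3 5))) (Sparse 3 4 1 2)))) (Sparse 0 2 4
   6))) (Sparse 0 1 4 6))) (Sparse 5 6 0 4)) (Sparse 3 4 0 6))) (Branch 3 5 (Branch 4 5 (Branch 3 6
   (Branch 4 6 (Branch 1 3 (Branch 2 3 (Branch 2 6 (Paths 2 6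
   [[3],[3,5],[0,1,3],[0,1,3,5],[0,1,3,5,4]]) (Branch 2 4 (Paths 3 5
   [[6],[2,4],[2,4,6],[1,0,2,4],[1,0,2,4,6]]) (Branch 1 5 (Paths 1 5
   [[3],[3,6],[0,2,3],[0,2,3,6],[0,2,3,6,4]]) (Branch 2 5 (Paths 2 5
   [[3],[3,6],[0,1,3],[0,1,3,6],[0,1,3,6,4]]) (Branch 1 6 (Paths 1 6
   [[3],[3,5],[0,2,3],[0,2,3,5],[0,2,3,5,4]]) (Branch 1 4 (Paths 3 5
   [[6],[1,4],[1,4,6],[2,0,1,4],[2,0,1,4,6]]) (Cut 3 [0,1,2] [4,5,6]))))))) (Branch 2 4 (Branch 1 5
   (Paths 1 3 [[5],[5,6],[5,4,6],[0,2,4,5],[0,2,4,6,5]]) (Branch 1 6 (Paths 1 3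
   [[6],[6,5],[6,4,5],[0,2,4,5],[0,2,4,6,5]]) (Branch 1 2 (Paths 3 5
   [[6],[6,4],[1,2,4],[1,0,2,4],[1,0,2,4,6]]) (Branch 2 5 (Paths 2 4
   [[5],[5,6],[5,3,6],[0,1,3,5],[0,1,3,5,6]]) (Branch 2 6 (Paths 2 4
   [[6],[6,5],[6,3,5],[0,1,3,5],[0,1,3,5,6]]) (Sparse 5 6 1 2)))))) (Sparse 0 2 3 4))) (Branch 1 4
   (Branch 2 4 (Branch 2 3 (Paths 3 5 [[6],[2,4],[2,4,6],[2,0,1,4],[2,0,1,4,6]]) (Branch 2 5 (Paths
   2 5 [[4],[4,6],[0,1,4],[0,1,4,6],[0,1,4,6,3]]) (Branch 2 6 (Paths 2 6
   [[4],[4,5],[0,1,4],[0,1,4,5],[0,1,4,5,3]]) (Branch 1 5 (Paths 1 5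
   [[4],[4,6],[0,2,4],[0,2,4,6],[0,2,4,6,3]]) (Branch 1 6 (Paths 1 6
   [[4],[4,5],[0,2,4],[0,2,4,5],[0,2,4,5,3]]) (Cut 4 [0,1,2] [3,5,6])))))) (Branch 2 3 (Branch 1 5
   (Paths 1 4 [[5],[5,6],[5,3,6],[0,2,3,5],[0,2,3,6,5]]) (Branch 1 2 (Paths 3 5
   [[6],[6,4],[2,1,4],[2,0,1,4],[2,0,1,4,6]]) (Branch 2 6 (Paths 2 3
   [[6],[6,5],[6,4,5],[0,1,4,5],[0,1,4,5,6]]) (Branch 2 5 (Paths 2 3
   [[5],[5,6],[5,4,6],[0,1,4,5],[0,1,4,5,6]]) (Branch 1 6 (Paths 1 4
   [[6],[6,5],[6,3,5],[0,2,3,5],[0,2,3,6,5]]) (Sparse 5 6 1 2)))))) (Sparse 0 2 3 4))) (Sparse 0 1 3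
   4))) (Sparse 3 6 0 4)) (Sparse 4 6 0 3)) (Sparse 3 5 0 4)) (Sparse 4 5 0 3))) (Branch 3 5 (Branch
   3 6 (Branch 4 5 (Branch 4 6 (Branch 1 6 (Branch 2 5 (Branch 1 4 (Branch 3 4 (Paths 1 4
   [[6],[6,3],[0,2,5],[0,2,5,3],[0,2,5,3,6]]) (Branch 2 4 (Paths 1 4
   [[6],[0,2],[0,2,5],[6,3,5,2],[0,2,5,3,6]]) (Branch 2 3 (Paths 3 5
   [[2],[6,4],[6,1,4],[6,1,0,2],[6,4,1,0,2]]) (Sparse 0 2 3 4)))) (Branch 1 3 (Branch 2 3 (Paths 1 3
   [[6],[0,2],[0,2,5],[6,4,5,2],[0,2,5,4,6]]) (Branch 3 4 (Paths 1 3
   [[6],[6,4],[0,2,5],[0,2,5,4],[0,2,5,4,6]]) (Branch 2 4 (Paths 3 6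
   [[1],[5,4],[5,2,4],[5,2,0,1],[1,0,2,5,4]]) (Sparse 0 2 3 4)))) (Branch 3 4 (Branch 1 2 (Paths 3 5
   [[4],[6,4],[6,1,2],[6,1,0,2],[4,6,1,0,2]]) (Branch 2 3 (Paths 2 3
   [[5],[5,4],[0,1,6],[0,1,6,4],[0,1,6,4,5]]) (Branch 2 4 (Paths 2 4
   [[5],[5,3],[0,1,6],[0,1,6,3],[0,1,6,3,5]]) (Sparse 3 4 1 2)))) (Sparse 0 1 3 4)))) (Branch 2 6
   (Branch 1 3 (Branch 1 5 (Paths 3 5 [[1],[6,1],[1,6,4],[6,2,0,1],[1,0,2,6,4]]) (Branch 3 4 (Paths
   1 3 [[6],[6,4],[0,2,6],[0,2,6,4],[0,2,6,4,5]]) (Branch 2 4 (Paths 1 6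
   [[3],[0,2],[0,2,4],[3,5,4,2],[0,2,4,5,3]]) (Branch 2 3 (Branch 1 4 (Paths 1 6
   [[4],[0,2],[0,2,3],[4,5,3,2],[0,2,3,5,4]]) (Branch 1 2 (Paths 1 3
   [[6],[2,6],[0,2,6],[2,6,4,5],[0,2,6,4,5]]) (Sparse 4 5 1 2))) (Sparse 0 2 3 4))))) (Branch 1 4
   (Branch 1 5 (Paths 4 5 [[1],[6,1],[1,6,3],[6,2,0,1],[1,0,2,6,3]]) (Branch 1 2 (Paths 1 4
   [[6],[2,6],[0,2,6],[2,6,3,5],[0,2,6,3,5]]) (Branch 2 3 (Paths 1 6
   [[4],[0,2],[0,2,3],[4,5,3,2],[0,2,3,5,4]]) (Sparse 3 5 1 2)))) (Branch 3 4 (Branch 2 4 (Paths 2 4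
   [[6],[6,3],[0,1,6],[0,1,6,3],[0,1,6,3,5]]) (Branch 2 3 (Paths 2 3
   [[6],[6,4],[0,1,6],[0,1,6,4],[0,1,6,4,5]]) (Branch 1 5 (Paths 3 5
   [[4],[6,1],[4,6,1],[6,2,0,1],[4,6,2,0,1]]) (Cut 6 [0,1,2] [3,4,5])))) (Sparse 0 1 3 4)))) (Sparse
   0 2 5 6))) (Branch 1 5 (Branch 2 6 (Branch 3 4 (Branch 2 3 (Paths 2 3
   [[6],[6,4],[0,1,5],[0,1,5,4],[0,1,5,4,6]]) (Branch 1 4 (Paths 1 4
   [[5],[5,3],[0,2,6],[0,2,6,3],[0,2,6,3,5]]) (Branch 1 3 (Paths 1 3
   [[5],[5,4],[0,2,6],[0,2,6,4],[0,2,6,4,5]]) (Branch 2 4 (Paths 2 4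
   [[6],[6,3],[0,1,5],[0,1,5,3],[0,1,5,3,6]]) (Branch 1 2 (Paths 3 5
   [[4],[6,4],[6,2,1],[6,2,0,1],[4,6,2,0,1]]) (Sparse 3 4 1 2)))))) (Branch 2 4 (Branch 1 3 (Paths 3
   5 [[1],[6,4],[6,2,4],[6,2,0,1],[6,4,2,0,1]]) (Branch 1 4 (Paths 1 4
   [[5],[0,2],[0,2,6],[5,3,6,2],[0,2,6,3,5]]) (Sparse 0 1 3 4))) (Branch 2 3 (Branch 1 4 (Paths 3 6
   [[2],[5,4],[5,1,4],[5,1,0,2],[5,4,1,0,2]]) (Branch 1 3 (Paths 1 3
   [[5],[0,2],[0,2,6],[5,4,6,2],[0,2,6,4,5]]) (Sparse 0 1 3 4))) (Sparse 0 2 3 4)))) (Branch 2 5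
   (Branch 1 2 (Branch 2 3 (Paths 1 5 [[2],[2,3],[0,2,3],[2,3,6,4],[0,2,3,6,4]]) (Branch 2 4 (Paths
   1 5 [[2],[2,4],[0,2,4],[2,4,6,3],[0,2,4,6,3]]) (Branch 1 4 (Paths 1 4
   [[5],[2,5],[0,2,5],[2,5,3,6],[0,2,5,3,6]]) (Branch 1 3 (Paths 1 3
   [[5],[2,5],[0,2,5],[2,5,4,6],[0,2,5,4,6]]) (Cut 5 [0,1,2] [3,4,6]))))) (Branch 2 3 (Branch 1 4
   (Paths 1 5 [[4],[0,2],[0,2,3],[4,6,3,2],[0,2,3,6,4]]) (Branch 2 4 (Branch 1 3 (Paths 1 5
   [[3],[0,2],[0,2,4],[3,6,4,2],[0,2,4,6,3]]) (Branch 3 4 (Paths 2 3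
   [[5],[5,4],[0,1,5],[0,1,5,4],[0,1,5,4,6]]) (Sparse 0 1 3 4))) (Sparse 4 6 1 2))) (Branch 1 3
   (Branch 2 4 (Paths 1 5 [[3],[0,2],[0,2,4],[3,6,4,2],[0,2,4,6,3]]) (Branch 3 4 (Paths 1 3
   [[5],[5,4],[0,2,5],[0,2,5,4],[0,2,5,4,6]]) (Sparse 0 2 3 4))) (Sparse 3 6 1 2)))) (Sparse 0 2 5
   6))) (Sparse 0 1 5 6))) (Sparse 4 5 0 6)) (Sparse 4 6 0 5)) (Sparse 3 5 0 6)) (Sparse 3 6 0 5)))
   (Cut 2 [0] [1,3,4,5,6])) (Cut 1 [0] [2,3,4,5,6])"

text \<open>The neighbours of \<open>0\<close> are exactly \<open>1\<close>, \<open>2\<close>,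
  \<open>3\<close>. The three pairs among \<open>4\<close>, \<open>5\<close>, \<open>6\<close> are
  split on near the root: at most one of them can be a non-edge. Four known non-neighbours
  contradict the degree bound.\<close>

definition certificate_3 :: certificate where
 "certificate_3 =
  Branch 5 6 (Branch 4 6 (Branch 3 5 (Branch 1 4 (Branch 4 5 (Branch 2 6 (Branch 3 4 (Paths 3 4
   [[5],[0,1],[0,2,6],[0,2,6,5],[5,6,2,0,1]]) (Branch 1 3 (Paths 1 3
   [[0],[4,5],[4,6,5],[0,2,6,5],[0,2,6,4,5]]) (Branch 2 3 (Paths 2 3
   [[0],[6,5],[6,4,5],[0,1,4,5],[0,1,4,6,5]]) (Branch 3 6 (Paths 3 5
   [[6],[6,4],[0,1,4],[0,2,6,4],[6,2,0,1,4]]) (Low_Degree 3 [4,1,2,6]))))) (Branch 1 6 (Branch 1 2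
   (Paths 1 4 [[6],[6,5],[0,3,5],[0,3,5,6],[2,0,3,5,6]]) (Branch 2 3 (Paths 1 4
   [[6],[6,5],[0,3,5],[0,3,5,6],[0,2,3,5,6]]) (Branch 2 4 (Paths 1 4
   [[6],[0,2],[0,3,5],[0,3,5,6],[6,5,3,0,2]]) (Low_Degree 2 [6,1,3,4])))) (Branch 3 6 (Branch 1 2
   (Paths 3 5 [[6],[6,4],[0,1,4],[0,1,4,6],[0,2,1,4,6]]) (Branch 2 5 (Paths 3 5
   [[6],[0,2],[0,1,4],[0,1,4,6],[6,4,1,0,2]]) (Branch 2 3 (Paths 3 5
   [[6],[6,4],[0,1,4],[0,1,4,6],[2,0,1,4,6]]) (Low_Degree 2 [6,1,5,3])))) (Low_Degree 6
   [0,2,1,3])))) (Branch 2 4 (Branch 2 5 (Branch 1 6 (Paths 1 4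
   [[6],[0,2],[6,5,2],[0,3,5,6],[6,5,3,0,2]]) (Branch 3 6 (Paths 3 5
   [[6],[0,2],[6,4,2],[0,1,4,6],[6,4,1,0,2]]) (Branch 2 6 (Paths 4 6
   [[2],[2,5],[1,0,2],[1,0,3,5],[1,0,3,5,2]]) (Low_Degree 6 [0,1,3,2])))) (Branch 1 5 (Branch 2 3
   (Paths 0 2 [[3],[1,4],[1,5,3],[3,5,6,4],[1,4,6,5,3]]) (Branch 1 2 (Paths 0 2
   [[1],[1,4],[3,5,1],[3,5,6,4],[3,5,6,4,1]]) (Branch 2 6 (Paths 2 4
   [[6],[0,1],[6,5,1],[0,3,5,6],[6,5,3,0,1]]) (Low_Degree 2 [5,3,1,6])))) (Low_Degree 5 [0,4,2,1])))
   (Branch 2 5 (Branch 3 4 (Branch 1 6 (Paths 1 4 [[6],[0,3],[6,5,3],[0,2,5,6],[6,5,2,0,3]]) (Branch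
   2 6 (Paths 2 5 [[6],[0,3],[6,4,3],[0,1,4,6],[6,4,1,0,3]]) (Branch 3 6 (Paths 4 6
   [[3],[3,5],[1,0,3],[1,0,2,5],[1,0,2,5,3]]) (Low_Degree 6 [0,1,2,3])))) (Low_Degree 4 [0,5,2,3]))
   (Sparse 0 2 4 5)))) (Branch 4 5 (Branch 2 4 (Branch 1 2 (Branch 1 5 (Paths 0 1
   [[2],[3,5],[2,4,5],[3,5,4,2],[3,5,6,4,2]]) (Branch 1 6 (Paths 1 2
   [[0],[6,4],[6,5,4],[0,3,5,4],[0,3,5,6,4]]) (Branch 1 3 (Paths 0 2
   [[1],[3,1],[3,5,4],[3,5,6,4],[1,3,5,6,4]]) (Low_Degree 1 [4,5,6,3])))) (Branch 1 5 (Branch 1 6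
   (Paths 1 5 [[6],[0,3],[0,2,4],[0,2,4,6],[6,4,2,0,3]]) (Branch 1 3 (Paths 0 1
   [[3],[3,5],[2,4,5],[2,4,5,3],[2,4,6,5,3]]) (Low_Degree 1 [4,2,6,3]))) (Branch 1 3 (Branch 1 6
   (Paths 1 3 [[0],[6,5],[6,4,5],[0,2,4,5],[0,2,4,6,5]]) (Low_Degree 1 [4,2,5,6])) (Low_Degree 1
   [4,2,5,3])))) (Branch 3 4 (Branch 2 3 (Branch 1 6 (Paths 3 4
   [[5],[5,6],[0,1,6],[0,1,6,5],[2,0,1,6,5]]) (Branch 1 5 (Paths 3 4
   [[5],[5,6],[0,1,5],[0,1,5,6],[2,0,1,5,6]]) (Branch 1 2 (Branch 2 5 (Paths 3 4
   [[5],[5,6],[0,2,5],[0,2,5,6],[0,1,2,5,6]]) (Branch 2 6 (Paths 3 4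
   [[5],[5,6],[0,2,6],[0,2,6,5],[0,1,2,6,5]]) (Cut 3 [0,1,2] [4,5,6]))) (Low_Degree 1 [4,6,5,2]))))
   (Branch 1 2 (Branch 2 5 (Paths 3 4 [[5],[5,6],[0,2,5],[0,2,5,6],[0,1,2,5,6]]) (Branch 2 6 (Paths
   3 4 [[5],[5,6],[0,2,6],[0,2,6,5],[0,1,2,6,5]]) (Low_Degree 2 [4,3,5,6]))) (Branch 1 3 (Branch 2 5
   (Paths 3 4 [[5],[5,6],[0,2,5],[0,2,5,6],[1,0,2,5,6]]) (Low_Degree 2 [4,3,1,5])) (Sparse 3 4 1
   2)))) (Low_Degree 4 [0,1,2,3]))) (Branch 1 5 (Branch 2 4 (Branch 3 4 (Branch 1 6 (Paths 1 5
   [[6],[0,3],[6,4,3],[0,2,4,6],[6,4,2,0,3]]) (Branch 2 6 (Paths 2 4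
   [[6],[0,3],[6,5,3],[0,1,5,6],[6,5,1,0,3]]) (Branch 3 6 (Paths 4 6
   [[3],[3,5],[2,0,3],[2,0,1,5],[2,0,1,5,3]]) (Low_Degree 6 [0,1,2,3])))) (Low_Degree 4 [0,1,5,3]))
   (Low_Degree 4 [0,1,5,2])) (Sparse 0 1 4 5)))) (Branch 4 5 (Branch 1 5 (Branch 3 6 (Branch 1 6
   (Branch 1 2 (Paths 1 5 [[6],[6,4],[0,3,6],[0,3,6,4],[2,0,3,6,4]]) (Branch 2 3 (Paths 1 5
   [[6],[6,4],[0,3,6],[0,3,6,4],[0,2,3,6,4]]) (Branch 2 4 (Paths 1 5
   [[6],[6,4],[0,2,4],[0,3,6,4],[6,3,0,2,4]]) (Branch 2 5 (Branch 1 3 (Paths 0 1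
   [[3],[2,5],[3,6,5],[2,5,6,3],[2,5,4,6,3]]) (Branch 1 4 (Paths 1 4
   [[5],[5,6],[0,3,6],[0,2,5,6],[5,2,0,3,6]]) (Sparse 3 4 1 2))) (Low_Degree 2 [1,3,4,5])))))
   (Branch 2 5 (Branch 1 4 (Paths 1 4 [[5],[5,6],[0,3,6],[0,2,5,6],[5,2,0,3,6]]) (Branch 1 3 (Paths
   0 1 [[3],[2,5],[3,6,5],[2,5,6,3],[2,5,4,6,3]]) (Branch 1 2 (Paths 0 1
   [[2],[2,5],[3,6,5],[3,6,5,2],[3,6,4,5,2]]) (Low_Degree 1 [6,4,3,2])))) (Branch 2 6 (Branch 2 4
   (Paths 2 4 [[6],[6,5],[0,1,5],[0,3,6,5],[6,3,0,1,5]]) (Branch 3 4 (Paths 3 4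
   [[6],[6,5],[0,1,5],[0,2,6,5],[6,2,0,1,5]]) (Branch 2 3 (Paths 0 2
   [[3],[3,6],[1,5,6],[1,5,6,3],[1,5,4,6,3]]) (Sparse 4 5 2 3)))) (Branch 2 4 (Branch 1 2 (Paths 1 2
   [[0],[5,4],[5,6,4],[5,6,3,0],[5,4,6,3,0]]) (Branch 2 3 (Paths 2 3
   [[0],[4,6],[4,5,6],[0,1,5,6],[0,1,5,4,6]]) (Low_Degree 2 [5,6,1,3]))) (Branch 1 2 (Branch 2 3
   (Paths 0 1 [[2],[3,2],[3,6,5],[3,6,4,5],[2,3,6,4,5]]) (Low_Degree 2 [5,6,4,3])) (Low_Degree 2
   [5,6,4,1])))))) (Branch 3 4 (Branch 1 3 (Branch 2 6 (Paths 1 3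
   [[0],[5,4],[5,6,4],[5,6,2,0],[5,4,6,2,0]]) (Branch 2 3 (Paths 0 1
   [[3],[2,3],[3,4,5],[3,4,6,5],[2,3,4,6,5]]) (Branch 2 5 (Paths 0 1
   [[3],[2,5],[3,4,5],[2,5,4,3],[2,5,6,4,3]]) (Sparse 5 6 2 3)))) (Branch 2 3 (Branch 2 6 (Paths 2 3
   [[0],[6,4],[6,5,4],[0,1,5,4],[0,1,5,6,4]]) (Branch 1 6 (Paths 1 5
   [[6],[6,4],[0,3,4],[0,3,4,6],[0,2,3,4,6]]) (Low_Degree 6 [0,3,2,1]))) (Low_Degree 3 [5,6,1,2])))
   (Branch 1 3 (Branch 2 3 (Branch 2 6 (Paths 0 1 [[3],[2,3],[2,6,5],[2,6,4,5],[3,2,6,4,5]]) (Branch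
   1 6 (Branch 2 4 (Paths 0 1 [[3],[2,3],[2,4,5],[2,4,6,5],[3,2,4,6,5]]) (Branch 2 5 (Paths 1 6
   [[5],[5,4],[0,2,5],[0,2,5,4],[3,0,2,5,4]]) (Cut 1 [0,2,3] [4,5,6]))) (Low_Degree 6 [0,3,2,1])))
   (Low_Degree 3 [5,6,4,2])) (Low_Degree 3 [5,6,4,1])))) (Branch 2 5 (Branch 1 4 (Branch 2 3 (Branch
   3 4 (Paths 0 3 [[2],[1,4],[2,5,4],[1,4,5,2],[1,4,6,5,2]]) (Branch 1 3 (Paths 0 1
   [[3],[2,3],[2,5,4],[2,5,6,4],[3,2,5,6,4]]) (Branch 3 6 (Paths 2 3
   [[0],[5,6],[5,4,6],[5,4,1,0],[5,6,4,1,0]]) (Low_Degree 3 [5,4,1,6])))) (Branch 1 3 (Branch 3 4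
   (Paths 0 1 [[3],[3,4],[2,5,4],[2,5,4,3],[2,5,6,4,3]]) (Branch 3 6 (Paths 1 3
   [[0],[4,6],[4,5,6],[4,5,2,0],[4,6,5,2,0]]) (Low_Degree 3 [5,2,4,6]))) (Branch 1 2 (Branch 3 4
   (Paths 0 1 [[2],[3,4],[2,5,4],[3,4,5,2],[3,4,6,5,2]]) (Low_Degree 3 [5,2,1,4])) (Sparse 2 5 1
   3)))) (Branch 1 3 (Branch 1 2 (Branch 3 4 (Paths 0 2 [[1],[3,1],[3,4,5],[3,4,6,5],[1,3,4,6,5]])
   (Branch 1 6 (Paths 0 2 [[1],[3,1],[1,6,5],[1,6,4,5],[3,1,6,4,5]]) (Branch 3 6 (Paths 0 2
   [[1],[3,1],[3,6,5],[3,6,4,5],[1,3,6,4,5]]) (Cut 2 [0,1,3] [4,5,6])))) (Branch 1 6 (Branch 3 4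
   (Paths 1 3 [[0],[6,4],[6,5,4],[0,2,5,4],[0,2,5,6,4]]) (Branch 2 4 (Paths 2 4
   [[5],[5,6],[0,1,6],[0,1,6,5],[0,3,1,6,5]]) (Low_Degree 4 [0,1,3,2]))) (Low_Degree 1 [5,4,2,6])))
   (Branch 3 4 (Branch 1 2 (Branch 1 6 (Paths 1 2 [[0],[6,5],[6,4,5],[0,3,4,5],[0,3,4,6,5]])
   (Low_Degree 1 [5,4,3,6])) (Low_Degree 1 [5,4,3,2])) (Sparse 4 5 1 3)))) (Low_Degree 5
   [0,3,1,2]))) (Branch 3 4 (Branch 1 5 (Branch 2 5 (Branch 2 4 (Branch 3 6 (Paths 3 4
   [[6],[0,2],[6,5,2],[0,1,5,6],[6,5,1,0,2]]) (Branch 2 3 (Paths 0 3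
   [[2],[2,4],[1,5,2],[1,5,6,4],[1,5,6,4,2]]) (Branch 1 3 (Paths 0 1
   [[3],[2,5],[2,4,3],[3,4,6,5],[2,5,6,4,3]]) (Low_Degree 3 [5,6,2,1])))) (Branch 1 4 (Branch 1 6
   (Paths 4 6 [[1],[1,5],[3,0,1],[3,0,2,5],[3,0,2,5,1]]) (Branch 2 6 (Paths 2 5
   [[6],[0,1],[6,4,1],[0,3,4,6],[6,4,3,0,1]]) (Branch 3 6 (Paths 3 4
   [[6],[0,1],[6,5,1],[0,2,5,6],[6,5,2,0,1]]) (Low_Degree 6 [0,1,2,3])))) (Low_Degree 4 [0,5,2,1])))
   (Low_Degree 5 [0,3,4,2])) (Low_Degree 5 [0,3,4,1])) (Sparse 0 3 4 5)))) (Branch 4 5 (Branch 1 4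
   (Branch 2 6 (Branch 3 6 (Branch 2 4 (Branch 2 5 (Paths 4 5
   [[2],[2,6],[1,0,2],[1,0,3,6],[1,0,3,6,2]]) (Branch 1 5 (Paths 1 4
   [[5],[0,2],[5,6,2],[0,3,6,5],[5,6,3,0,2]]) (Branch 3 5 (Paths 3 6
   [[5],[0,2],[5,4,2],[0,1,4,5],[5,4,1,0,2]]) (Low_Degree 5 [0,2,1,3])))) (Branch 3 4 (Branch 2 3
   (Paths 0 2 [[3],[3,6],[1,4,3],[1,4,5,6],[1,4,5,6,3]]) (Branch 1 2 (Paths 0 1
   [[2],[3,4],[3,6,2],[2,6,5,4],[3,4,5,6,2]]) (Branch 2 5 (Paths 2 6
   [[5],[0,3],[5,4,3],[0,1,4,5],[5,4,1,0,3]]) (Low_Degree 2 [4,3,1,5])))) (Low_Degree 4 [0,6,2,3])))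
   (Branch 3 4 (Branch 1 6 (Branch 2 3 (Paths 0 2 [[3],[1,6],[1,4,3],[3,4,5,6],[1,6,5,4,3]]) (Branch
   3 5 (Paths 3 4 [[5],[0,1],[5,6,1],[0,2,6,5],[5,6,2,0,1]]) (Branch 1 3 (Paths 0 3
   [[1],[1,4],[2,6,1],[2,6,5,4],[2,6,5,4,1]]) (Low_Degree 3 [6,2,5,1])))) (Low_Degree 6 [0,4,3,1]))
   (Sparse 0 3 4 6))) (Branch 2 4 (Branch 1 6 (Branch 3 6 (Branch 2 5 (Paths 2 4
   [[5],[0,1],[5,6,1],[0,3,6,5],[5,6,3,0,1]]) (Branch 2 3 (Paths 0 2
   [[3],[1,4],[1,6,3],[3,6,5,4],[1,4,5,6,3]]) (Branch 1 2 (Paths 0 2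
   [[1],[1,4],[3,6,1],[3,6,5,4],[3,6,5,4,1]]) (Low_Degree 2 [6,5,3,1])))) (Low_Degree 6 [0,4,2,3]))
   (Low_Degree 6 [0,4,2,1])) (Sparse 0 2 4 6))) (Branch 1 6 (Branch 2 4 (Branch 3 4 (Branch 3 6
   (Branch 1 2 (Paths 0 1 [[2],[3,6],[3,4,2],[2,4,5,6],[3,6,5,4,2]]) (Branch 1 3 (Paths 0 1
   [[3],[3,6],[2,4,3],[2,4,5,6],[2,4,5,6,3]]) (Branch 1 5 (Paths 1 6
   [[5],[0,3],[5,4,3],[0,2,4,5],[5,4,2,0,3]]) (Low_Degree 1 [4,2,3,5])))) (Branch 2 6 (Branch 1 3
   (Paths 0 1 [[3],[2,6],[2,4,3],[3,4,5,6],[2,6,5,4,3]]) (Branch 3 5 (Paths 3 4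
   [[5],[0,2],[5,6,2],[0,1,6,5],[5,6,1,0,2]]) (Branch 2 3 (Paths 0 3
   [[2],[2,4],[1,6,2],[1,6,5,4],[1,6,5,4,2]]) (Low_Degree 3 [6,1,5,2])))) (Low_Degree 6 [0,4,3,2])))
   (Low_Degree 4 [0,6,1,3])) (Low_Degree 4 [0,6,1,2])) (Sparse 0 1 4 6))) (Sparse 5 6 0 4))) (Branch
   4 5 (Branch 4 6 (Branch 2 5 (Branch 3 6 (Branch 1 6 (Branch 1 5 (Branch 3 4 (Paths 3 6
   [[4],[0,1],[4,5,1],[0,2,5,4],[4,5,2,0,1]]) (Branch 1 4 (Paths 4 5
   [[1],[6,1],[1,0,2],[6,3,0,2],[1,6,3,0,2]]) (Branch 2 4 (Paths 2 5
   [[4],[0,1],[4,6,1],[0,3,6,4],[4,6,3,0,1]]) (Low_Degree 4 [0,3,1,2])))) (Branch 3 5 (Branch 1 3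
   (Paths 0 1 [[3],[3,6],[2,5,3],[2,5,4,6],[2,5,4,6,3]]) (Branch 1 2 (Paths 0 1
   [[2],[3,6],[3,5,2],[2,5,4,6],[3,6,4,5,2]]) (Branch 1 4 (Paths 1 6
   [[4],[0,3],[4,5,3],[0,2,5,4],[4,5,2,0,3]]) (Low_Degree 1 [5,3,2,4])))) (Low_Degree 5 [0,6,1,3])))
   (Branch 1 5 (Branch 2 6 (Branch 1 2 (Paths 0 1 [[2],[2,5],[3,6,2],[3,6,4,5],[3,6,4,5,2]]) (Branch
   1 3 (Paths 0 1 [[3],[2,5],[2,6,3],[3,6,4,5],[2,5,4,6,3]]) (Branch 1 4 (Paths 1 5
   [[4],[0,2],[4,6,2],[0,3,6,4],[4,6,3,0,2]]) (Low_Degree 1 [6,2,3,4])))) (Low_Degree 6 [0,5,1,2]))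
   (Sparse 0 1 5 6))) (Branch 3 5 (Branch 1 6 (Branch 2 6 (Branch 2 3 (Paths 0 3
   [[2],[2,5],[1,6,2],[1,6,4,5],[1,6,4,5,2]]) (Branch 3 4 (Paths 3 5
   [[4],[0,2],[4,6,2],[0,1,6,4],[4,6,1,0,2]]) (Branch 1 3 (Paths 0 1
   [[3],[2,6],[2,5,3],[3,5,4,6],[2,6,4,5,3]]) (Low_Degree 3 [6,2,4,1])))) (Low_Degree 6 [0,5,3,2]))
   (Low_Degree 6 [0,5,3,1])) (Sparse 0 3 5 6))) (Branch 2 6 (Branch 1 5 (Branch 3 5 (Branch 1 6
   (Branch 1 2 (Paths 0 2 [[1],[1,6],[3,5,1],[3,5,4,6],[3,5,4,6,1]]) (Branch 2 4 (Paths 2 6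
   [[4],[0,1],[4,5,1],[0,3,5,4],[4,5,3,0,1]]) (Branch 2 3 (Paths 0 2
   [[3],[1,6],[1,5,3],[3,5,4,6],[1,6,4,5,3]]) (Low_Degree 2 [5,1,4,3])))) (Branch 3 6 (Branch 1 2
   (Paths 0 1 [[2],[3,5],[3,6,2],[2,6,4,5],[3,5,4,6,2]]) (Branch 2 3 (Paths 0 2
   [[3],[3,6],[1,5,3],[1,5,4,6],[1,5,4,6,3]]) (Branch 2 4 (Paths 2 6
   [[4],[0,3],[4,5,3],[0,1,5,4],[4,5,1,0,3]]) (Low_Degree 2 [5,1,3,4])))) (Low_Degree 6 [0,5,1,3])))
   (Low_Degree 5 [0,6,2,3])) (Low_Degree 5 [0,6,2,1])) (Sparse 0 2 5 6))) (Sparse 4 5 0 6)) (Sparse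
   4 6 0 5))"

text \<open>Only \<open>1\<close>, \<open>2\<close>, \<open>3\<close>, \<open>4\<close> are known to
  be neighbours of \<open>0\<close>; the pairs \<open>0 5\<close> and \<open>0 6\<close> are split
  on where they matter. Three known non-neighbours already contradict the degree bound.\<close>

definition certificate_ge4 :: certificate where
 "certificate_ge4 =
  Branch 2 6 (Branch 3 5 (Branch 3 4 (Branch 1 6 (Branch 2 5 (Branch 1 3 (Paths 0 1
   [[3],[4,3],[2,5,3],[3,5,2,6],[4,3,5,2,6]]) (Branch 1 2 (Paths 0 1
   [[2],[2,6],[3,5,2],[3,5,2,6],[4,3,5,2,6]]) (Branch 1 4 (Paths 1 4
   [[0],[0,3],[6,2,0],[6,2,5,3],[6,2,5,3,0]]) (Low_Degree 1 [3,2,4])))) (Branch 0 5 (Branch 2 4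
   (Paths 2 4 [[0],[0,3],[6,1,0],[6,1,0,3],[6,1,0,5,3]]) (Branch 2 3 (Branch 4 5 (Paths 0 4
   [[3],[2,3],[2,3,5],[1,6,2,3],[1,6,2,3,5]]) (Branch 1 4 (Paths 1 4
   [[0],[0,3],[6,2,0],[6,2,0,3],[6,2,0,5,3]]) (Low_Degree 4 [2,5,1]))) (Low_Degree 2 [5,4,3])))
   (Branch 1 5 (Branch 4 5 (Paths 0 3 [[4],[1,5],[1,5,4],[2,6,1,5],[2,6,1,5,4]]) (Low_Degree 5
   [2,0,4])) (Low_Degree 5 [2,0,1])))) (Branch 1 3 (Branch 4 6 (Branch 1 5 (Paths 0 1
   [[3],[4,3],[4,3,5],[2,6,4,3],[2,6,4,3,5]]) (Branch 1 2 (Branch 5 6 (Paths 0 4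
   [[3],[1,3],[2,1,3],[2,6,5,3],[1,2,6,5,3]]) (Branch 0 5 (Paths 3 4
   [[0],[5,0],[0,2,6],[5,0,2,6],[5,0,1,2,6]]) (Low_Degree 5 [1,6,0]))) (Low_Degree 1 [6,5,2])))
   (Branch 0 6 (Branch 5 6 (Branch 1 4 (Paths 3 4 [[0],[0,1],[5,6,0],[5,6,2,0],[5,6,2,0,1]]) (Branch
   1 2 (Paths 0 4 [[3],[1,3],[2,1,3],[2,6,5,3],[1,2,6,5,3]]) (Low_Degree 1 [6,4,2]))) (Low_Degree 6
   [1,4,5])) (Low_Degree 6 [1,4,0]))) (Branch 1 2 (Branch 1 4 (Branch 1 5 (Branch 0 6 (Paths 1 2
   [[0],[0,6],[5,3,0],[5,3,4,0],[5,3,4,0,6]]) (Branch 3 6 (Paths 1 4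
   [[0],[0,3],[5,3,0],[0,2,6,3],[5,3,6,2,0]]) (Low_Degree 6 [1,0,3]))) (Low_Degree 1 [6,3,5]))
   (Low_Degree 1 [6,3,4])) (Low_Degree 1 [6,3,2])))) (Branch 4 5 (Branch 1 4 (Branch 2 3 (Branch 3 6
   (Paths 0 2 [[3],[3,6],[4,5,3],[4,5,3,6],[1,4,5,3,6]]) (Branch 5 6 (Paths 0 3
   [[2],[4,5],[1,4,5],[4,5,6,2],[1,4,5,6,2]]) (Branch 0 6 (Paths 2 3
   [[0],[6,0],[0,4,5],[6,0,4,5],[6,0,1,4,5]]) (Low_Degree 6 [3,5,0])))) (Branch 1 3 (Branch 3 6
   (Paths 1 4 [[0],[3,5],[0,3,5],[3,6,2,0],[0,2,6,3,5]]) (Low_Degree 3 [4,2,6])) (Low_Degree 3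
   [4,2,1]))) (Branch 2 4 (Branch 4 6 (Branch 1 3 (Paths 0 2
   [[4],[4,6],[3,5,4],[3,5,4,6],[1,3,5,4,6]]) (Branch 1 2 (Paths 0 1
   [[2],[4,2],[4,6,2],[3,5,4,2],[3,5,4,6,2]]) (Low_Degree 1 [4,3,2]))) (Low_Degree 4 [3,1,6]))
   (Low_Degree 4 [3,1,2]))) (Branch 1 4 (Branch 2 4 (Branch 4 6 (Branch 1 5 (Paths 0 2
   [[4],[1,4],[1,4,6],[3,5,1,4],[3,5,1,4,6]]) (Branch 2 5 (Paths 0 1
   [[4],[2,4],[2,6,4],[3,5,2,4],[3,5,2,6,4]]) (Low_Degree 5 [4,1,2]))) (Low_Degree 4 [3,5,6]))
   (Low_Degree 4 [3,5,2])) (Low_Degree 4 [3,5,1])))) (Branch 0 5 (Branch 3 6 (Branch 4 5 (Branch 1 5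
   (Branch 3 4 (Paths 3 4 [[0],[0,5],[0,1,5],[6,2,0,5],[6,2,0,1,5]]) (Branch 1 3 (Paths 1 3
   [[0],[5,0],[0,2,6],[5,0,2,6],[5,4,0,2,6]]) (Low_Degree 3 [5,4,1]))) (Branch 2 5 (Branch 1 3
   (Paths 2 5 [[0],[0,4],[6,3,0],[6,3,0,4],[6,3,1,0,4]]) (Branch 1 4 (Paths 2 5
   [[0],[0,4],[0,1,4],[6,3,0,4],[6,3,0,1,4]]) (Low_Degree 1 [5,3,4]))) (Low_Degree 5 [3,1,2])))
   (Branch 1 5 (Branch 2 5 (Branch 1 4 (Paths 1 5 [[0],[0,2],[4,0,2],[0,3,6,2],[4,0,3,6,2]]) (Branch
   3 4 (Paths 2 5 [[0],[0,1],[6,3,0],[6,3,0,1],[6,3,4,0,1]]) (Low_Degree 4 [5,1,3]))) (Low_Degree 5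
   [3,4,2])) (Low_Degree 5 [3,4,1]))) (Branch 1 3 (Branch 3 4 (Branch 2 5 (Branch 1 6 (Paths 1 3
   [[0],[0,4],[6,2,0],[6,2,5,0],[6,2,5,0,4]]) (Branch 4 6 (Paths 3 4
   [[0],[1,0],[0,2,6],[0,5,2,6],[1,0,5,2,6]]) (Low_Degree 6 [3,1,4]))) (Branch 1 5 (Branch 5 6
   (Paths 1 5 [[0],[3,0],[0,2,6],[3,0,2,6],[3,4,0,2,6]]) (Low_Degree 5 [3,2,6])) (Low_Degree 5
   [3,2,1]))) (Low_Degree 3 [5,6,4])) (Low_Degree 3 [5,6,1]))) (Branch 1 5 (Branch 2 5 (Branch 4 5
   (Branch 5 6 (Branch 3 6 (Branch 1 3 (Paths 0 1 [[3],[2,5],[2,6,3],[3,6,2,5],[4,5,2,6,3]]) (Branch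
   3 4 (Paths 2 6 [[5],[0,3],[0,4,3],[5,1,0,3],[5,1,0,4,3]]) (Low_Degree 3 [5,1,4]))) (Branch 1 3
   (Branch 2 3 (Paths 0 1 [[3],[2,3],[2,6,5],[3,2,6,5],[4,5,6,2,3]]) (Low_Degree 3 [5,6,2]))
   (Low_Degree 3 [5,6,1]))) (Low_Degree 5 [3,0,6])) (Low_Degree 5 [3,0,4])) (Low_Degree 5 [3,0,2]))
   (Low_Degree 5 [3,0,1])))) (Branch 3 6 (Branch 2 5 (Branch 4 6 (Branch 1 6 (Branch 1 2 (Branch 3 5
   (Paths 0 1 [[2],[3,6],[3,5,2],[2,5,3,6],[4,6,3,5,2]]) (Branch 4 5 (Paths 0 1
   [[2],[3,6],[4,5,2],[2,5,4,6],[3,6,4,5,2]]) (Branch 1 5 (Branch 1 3 (Paths 1 3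
   [[0],[2,0],[5,2,0],[2,0,4,6],[5,2,0,4,6]]) (Branch 2 3 (Paths 0 3
   [[2],[1,6],[1,5,2],[2,5,1,6],[4,6,1,5,2]]) (Low_Degree 3 [5,1,2]))) (Low_Degree 5 [3,4,1]))))
   (Branch 2 3 (Branch 2 4 (Branch 1 5 (Paths 0 3 [[2],[1,6],[2,4,6],[2,5,1,6],[1,5,2,4,6]]) (Branch
   1 4 (Branch 3 5 (Paths 0 4 [[2],[1,6],[3,5,2],[2,5,3,6],[1,6,3,5,2]]) (Branch 0 5 (Paths 2 3
   [[0],[5,0],[0,4,6],[5,0,4,6],[5,0,1,4,6]]) (Low_Degree 5 [1,3,0]))) (Low_Degree 1 [2,5,4])))
   (Low_Degree 2 [6,1,4])) (Low_Degree 2 [6,1,3]))) (Branch 5 6 (Branch 1 4 (Branch 2 4 (Paths 0 1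
   [[4],[2,4],[3,6,4],[2,5,6,4],[3,6,5,2,4]]) (Branch 1 2 (Paths 0 4
   [[1],[3,6],[2,5,6],[1,2,5,6],[3,6,5,2,1]]) (Low_Degree 2 [6,4,1]))) (Branch 1 2 (Branch 1 3
   (Paths 0 3 [[1],[4,6],[2,5,6],[1,2,5,6],[4,6,5,2,1]]) (Low_Degree 1 [6,4,3])) (Low_Degree 1
   [6,4,2]))) (Low_Degree 6 [2,1,5]))) (Branch 0 6 (Branch 1 6 (Branch 5 6 (Branch 1 4 (Branch 2 4
   (Paths 2 4 [[0],[0,1],[5,6,0],[5,6,3,0],[5,6,3,0,1]]) (Branch 1 2 (Paths 1 2
   [[0],[4,0],[0,6,5],[0,3,6,5],[4,0,3,6,5]]) (Low_Degree 2 [6,4,1]))) (Branch 2 4 (Branch 3 4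
   (Paths 0 3 [[4],[1,6],[2,5,6],[4,2,5,6],[1,6,5,2,4]]) (Low_Degree 4 [6,1,3])) (Low_Degree 4
   [6,1,2]))) (Low_Degree 6 [2,4,5])) (Low_Degree 6 [2,4,1])) (Low_Degree 6 [2,4,0]))) (Branch 1 2
   (Branch 2 3 (Branch 2 4 (Branch 1 5 (Branch 5 6 (Paths 0 1
   [[2],[3,2],[3,6,5],[2,3,6,5],[4,2,3,6,5]]) (Branch 3 5 (Branch 0 6 (Paths 1 2
   [[0],[0,4],[5,3,0],[5,3,0,4],[5,3,6,0,4]]) (Low_Degree 6 [2,5,0])) (Low_Degree 5 [2,6,3])))
   (Branch 4 5 (Branch 5 6 (Paths 0 3 [[2],[4,2],[4,5,6],[2,4,5,6],[1,2,4,5,6]]) (Low_Degree 5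
   [2,1,6])) (Low_Degree 5 [2,1,4]))) (Low_Degree 2 [6,5,4])) (Low_Degree 2 [6,5,3])) (Low_Degree 2
   [6,5,1]))) (Branch 0 6 (Branch 1 6 (Branch 4 6 (Branch 5 6 (Branch 2 3 (Branch 1 2 (Branch 3 5
   (Paths 2 3 [[0],[1,0],[0,6,5],[0,4,6,5],[1,0,4,6,5]]) (Branch 3 4 (Branch 4 5 (Paths 1 2
   [[0],[6,0],[6,0,3],[6,5,4,0],[6,5,4,0,3]]) (Branch 0 5 (Paths 1 2
   [[0],[0,3],[0,4,3],[6,5,0,3],[6,5,0,4,3]]) (Low_Degree 5 [3,4,0]))) (Low_Degree 3 [6,5,4])))
   (Branch 2 5 (Branch 1 3 (Paths 2 3 [[0],[0,1],[5,6,0],[5,6,4,0],[5,6,4,0,1]]) (Branch 1 4 (Paths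
   1 6 [[0],[4,0],[0,2,5],[0,3,2,5],[4,0,3,2,5]]) (Low_Degree 1 [2,3,4]))) (Low_Degree 2 [6,1,5])))
   (Branch 1 2 (Branch 2 5 (Branch 1 3 (Paths 1 2 [[0],[3,0],[0,6,5],[0,4,6,5],[3,0,4,6,5]])
   (Low_Degree 3 [6,2,1])) (Low_Degree 2 [6,3,5])) (Low_Degree 2 [6,3,1]))) (Low_Degree 6 [2,3,5]))
   (Low_Degree 6 [2,3,4])) (Low_Degree 6 [2,3,1])) (Low_Degree 6 [2,3,0])))"

text \<open>The initial lists record what the labelling says about vertex \<open>0\<close>. In the
  first case the pairs \<open>0 1\<close> and \<open>0 2\<close> are open; if one of them is
  missing, the other label is a cut vertex.\<close>

lemma certificates_valid:
  "check 0 [] [(0, 3), (0, 4), (0, 5), (0, 6)] certificate_le2"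
  "check 3 [(0, 1), (0, 2), (0, 3)] [(0, 4), (0, 5), (0, 6)] certificate_3"
  "check 4 [(0, 1), (0, 2), (0, 3), (0, 4)] [] certificate_ge4"
  by code_simp+

context adjacency begin

text \<open>This breaks the symmetry: the degree of \<open>v\<close> alone determines its whole
  adjacency row in the labelling.\<close>

lemma ex_labelling:
  assumes "finite V" "card V = n" "v \<in> V"
  shows "\<exists>f. inj_on f {..<n} \<and> f ` {..<n} = V \<and> f 0 = v \<and>
    (\<forall>i<n. 0 < i \<longrightarrow> E v (f i) = (i \<le> card (nbrs V v)))"
proof -
  have fin: "finite (nbrs V v)" using assms by (simp add: nbrs_def)
  obtain xs where xs: "set xs = nbrs V v" "distinct xs" using finite_distinct_list[OF fin] by auto
  obtain ys where ys: "set ys = V - {v} - nbrs V v" "distinct ys"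
    using finite_distinct_list[of "V - {v} - nbrs V v"] assms by auto
  have len: "length xs = card (nbrs V v)" using distinct_card[OF xs(2)] xs(1) by simp
  define l where "l = v # xs @ ys"
  have set_l: "set l = V" using xs ys assms by (auto simp: l_def nbrs_def)
  have dist: "distinct l" using xs ys irrefl by (auto simp: l_def nbrs_def)
  have "length l = n" using distinct_card[OF dist] set_l assms by simp
  have "E v (l ! i) = (i \<le> card (nbrs V v))" if i: "i < n" "0 < i" for i
  proof -
    obtain j where j: "i = Suc j" using i(2) gr0_implies_Suc by blast
    show ?thesis
    proof (cases "j < length xs")
      case True
      then have "l ! i \<in> set xs" by (simp add: j l_def nth_append)
      then show ?thesis using True xs len j by (simp add: nbrs_def)
    next
      case False
      then have "l ! i = ys ! (j - length xs)" by (simp add: j l_def nth_append)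
      moreover have "j - length xs < length ys" using False i(1) \<open>length l = n\<close> by (simp add: j l_def)
      ultimately have "l ! i \<in> set ys" by simp
      then show ?thesis using False ys len j by (simp add: nbrs_def)
    qed
  qed
  moreover have "inj_on ((!) l) {..<n}" using dist \<open>length l = n\<close> by (intro inj_on_nth) auto
  moreover have "(!) l ` {..<n} = V" using set_l \<open>length l = n\<close> 
    unfolding set_conv_nth by auto
  moreover have "l ! 0 = v" by (simp add: l_def)
  ultimately show ?thesis by blast
qed

lemma ex_pancyclic_pair_7:
  assumes "finite V" and card: "card V = 7" and sf: "sparse_free V" and bi: "biconn V"
  shows "\<exists>u v. pancyclic_pair V u v"
proof -
  have "V \<noteq> {}" using card by auto
  then obtain v where v: "v \<in> V" and min: "\<And>w. w \<in> V \<Longrightarrow> card (nbrs V v) \<le> card (nbrs V w)"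
    using ex_is_arg_min_if_finite[OF \<open>finite V\<close>, of "\<lambda>w. card (nbrs V w)"]
    by (auto simp: is_arg_min_linorder)
  obtain f where f: "inj_on f {..<7}" "f ` {..<7} = V" "f 0 = v"
    and adj: "\<And>i. 0 < i \<Longrightarrow> i < 7 \<Longrightarrow> E v (f i) = (i \<le> card (nbrs V v))"
    using ex_labelling[OF \<open>finite V\<close> card v] by blast
  consider "card (nbrs V v) \<le> 2" | "card (nbrs V v) = 3" | "4 \<le> card (nbrs V v)" by linarith
  then show ?thesis
  proof cases
    case 1
    then show ?thesis
      by (intro check_sound[OF f(1,2) sf bi _ certificates_valid(1)]) (auto simp: adj f(3))
  next
    case 2
    then show ?thesis using min
      by (intro check_sound[OF f(1,2) sf bi _ certificates_valid(2)]) (auto simp: adj f(3))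
  next
    case 3
    then have "4 \<le> card (nbrs V w)" if "w \<in> V" for w using min[OF that] by simp
    with 3 show ?thesis
      by (intro check_sound[OF f(1,2) sf bi _ certificates_valid(3)]) (auto simp: adj f(3))
  qed
qed

end

section \<open>The induction\<close>

context adjacency begin

text \<open>If deleting a vertex \<open>x\<close> of degree at least 3 creates a cut vertex
  \<open>s\<close>, then \<open>x\<close> and \<open>s\<close> separate the graph, and order 8
  leaves the six other vertices needed for a better choice.\<close>

lemma ex_deletable:
  assumes fin: "finite V" and card: "8 \<le> card V" and sf: "sparse_free V" and bi: "biconn V"
  shows "\<exists>a\<in>V. 3 \<le> card (nbrs V a) \<and> biconn (V - {a})"
proof -
  have "\<exists>x\<in>V. 3 \<le> card (nbrs V x)"
  proof (rule ccontr)
    assume no: "\<not> ?thesis"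
    have "V \<noteq> {}" using card by auto
    then obtain v where v: "v \<in> V" by blast
    define M where "M = V - insert v (nbrs V v)"
    have "card (nbrs V v) \<le> 2" using no v by auto
    moreover have "card (insert v (nbrs V v)) \<le> Suc (card (nbrs V v))" by (rule card_insert_le_m1) auto
    moreover have "card V - card (insert v (nbrs V v)) \<le> card M"
      unfolding M_def by (rule diff_card_le_card_Diff) (use fin in \<open>simp add: nbrs_def\<close>)
    \<comment> \<open>With all degrees at most 2, at least \<open>8 - 3\<close> vertices are
      non-neighbours of \<open>v\<close>.\<close>
    ultimately have "5 \<le> card M" using card by linarith
    then have "M \<noteq> {}" by auto
    then obtain z where z: "z \<in> M" by blast
    \<comment> \<open>By the matching of non-neighbours of \<open>v\<close>, the vertex
      \<open>z\<close> misses at most one of the other four or more vertices of \<open>M\<close>, so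
      its degree is at least 3 after all.\<close>
    then have "card (M - {z}) \<le> Suc (card (nbrs V z))"
    proof (intro card_nbrs_ge[OF fin])
      fix p q assume pq: "p \<in> M - {z}" "q \<in> M - {z}" "\<not> E z p" "\<not> E z q"
      show "p = q"
      proof (rule ccontr)
        assume "p \<noteq> q"
        then have "{v, z, p, q} \<subseteq> V" "distinct [v, z, p, q]" "\<not> E v z" "\<not> E v p" "\<not> E v q"
          using pq z v by (auto simp: M_def nbrs_def)
        from nonneighbours_matching[OF sf this] pq show False by blast
      qed
    qed (auto simp: M_def)
    then have "3 \<le> card (nbrs V z)" using \<open>5 \<le> card M\<close> z by (simp add: card_Diff_singleton)
    with no z show False by (auto simp: M_def)
  qed
  then obtain x where x: "x \<in> V" "3 \<le> card (nbrs V x)" by blast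
  show ?thesis
  proof (cases "biconn (V - {x})")
    case True
    with x show ?thesis by (intro bexI[of _ x] conjI)
  next
    case False
    then obtain s X Y where "s \<in> V - {x}" "X \<noteq> {}" "Y \<noteq> {}" "X \<inter> Y = {}" "X \<union> Y = V - {x} - {s}"
        "\<forall>p\<in>X. \<forall>q\<in>Y. \<not> E p q"
      by (elim not_biconnE)
    then have sep: "separation V x s X Y" using x unfolding separation_def by auto
    then have "card (V - {x, s}) = card X + card Y"
      using fin card_Un_disjoint[of X Y] unfolding separation_def by (metis finite_Diff finite_Un)
    moreover have "card (V - {x, s}) = card V - 2"
      using sep fin unfolding separation_def by (subst card_Diff_subset) auto
    ultimately have "6 \<le> card X + card Y" using card by simp
    then show ?thesis
      using ex_deletable_of_separation[OF fin bi sf sep]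
        ex_deletable_of_separation[OF fin bi sf separation_swap_sides[OF sep]] by linarith
  qed
qed

text \<open>Only \<open>k = card V\<close> asks for a new path; it comes from a spanning path of
  \<open>V - {a}\<close>, which has the required 6 vertices because \<open>V\<close> has at least
  7.\<close>

lemma pancyclic_pair_insert:
  assumes fin: "finite V" and card: "7 \<le> card V" and sf: "sparse_free V" and a: "a \<in> V"
    and deg: "3 \<le> card (nbrs V a)" and pc: "pancyclic_pair (V - {a}) u v"
  shows "pancyclic_pair V u v"
  unfolding pancyclic_pair_def
proof (intro conjI allI impI)
  show "E u v" using pc by (simp add: pancyclic_pair_def)
next
  fix k assume k: "3 \<le> k" "k \<le> card V"
  have card': "card (V - {a}) = card V - 1" using a by simp
  have path: "\<exists>p. upath u v p \<and> set p \<subseteq> V - {a} \<and> length p = j" if "3 \<le> j" "j \<le> card V - 1" for j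
    using pc that unfolding pancyclic_pair_def card' by simp
  show "\<exists>p. upath u v p \<and> set p \<subseteq> V \<and> length p = k"
  proof (cases "k = card V")
    case False
    then have "k \<le> card V - 1" using k by simp
    then obtain p where "upath u v p" "set p \<subseteq> V - {a}" "length p = k"
      using path k(1) by blast
    then show ?thesis by (intro exI[of _ p]) auto
  next
    case True
    have "3 \<le> card V - 1" using card by simp
    then obtain p where p: "upath u v p" "set p \<subseteq> V - {a}" "length p = card V - 1"
      using path by blast
    \<comment> \<open>A path of the largest length available in \<open>V - {a}\<close> visits all of
      it.\<close>
    then have "card (set p) = card (V - {a})"
      using card' by (simp add: distinct_card upath_def)
    then have sp: "set p = V - {a}" using p(2) fin by (intro card_subset_eq) auto
    then have "{y \<in> set p. E a y} = nbrs V a" using irrefl by (auto simp: nbrs_def)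
    moreover have "insert a (set p) = V" using sp a by blast
    moreover have "6 \<le> length p" using p(3) card by simp
    ultimately obtain q where q: "upath u v q" "set q = V"
      using insert_vertex[of u v p a] p(1) sp sf deg by auto
    then have "length q = card V" by (auto simp: upath_def distinct_card)
    then show ?thesis using q True by blast
  qed
qed

lemma ex_pancyclic_pair:
  assumes "finite V" "7 \<le> card V" "sparse_free V" "biconn V"
  shows "\<exists>u v. pancyclic_pair V u v"
  using assms
proof (induction "card V" arbitrary: V rule: less_induct)
  case less
  show ?case
  proof (cases "card V = 7")
    case True
    show ?thesis by (rule ex_pancyclic_pair_7[OF less.prems(1) True less.prems(3,4)])
  next
    case False
    then have "8 \<le> card V" using less.prems(2) by linarith
    then obtain a where a: "a \<in> V" "3 \<le> card (nbrs V a)" "biconn (V - {a})"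
      using ex_deletable[OF less.prems(1) _ less.prems(3,4)] by metis
    have card: "card (V - {a}) = card V - 1" using a(1) by simp
    have "\<exists>u v. pancyclic_pair (V - {a}) u v"
    proof (rule less.hyps)
      show "sparse_free (V - {a})" using less.prems(3) by (rule sparse_free_subset) simp
    qed (use a(3) less.prems(1) card \<open>8 \<le> card V\<close> in simp_all)
    then obtain u v where "pancyclic_pair (V - {a}) u v" by blast
    then have "pancyclic_pair V u v"
      by (rule pancyclic_pair_insert[OF less.prems(1,2,3) a(1,2)])
    then show ?thesis by (intro exI)
  qed
qed

end

section \<open>Transfer to digraphs\<close>

lemma (in wf_digraph) ex_awalk_of_successively:
  assumes "successively (dominates G) p" "p \<noteq> []" "set p \<subseteq> verts G"
  shows "\<exists>es. awalk (hd p) es (last p) \<and> awalk_verts (hd p) es = p"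
  using assms
proof (induction p rule: induct_list012)
  case (2 x)
  then show ?case by (intro exI[of _ "[]"]) (simp add: awalk_Nil_iff)
next
  case (3 x y p)
  then obtain es where es: "awalk y es (last (y # p))" "awalk_verts y es = y # p" by auto
  obtain e where "e \<in> arcs G" "tail G e = x" "head G e = y" using 3(3) by auto
  with es 3(5) show ?case by (intro exI[of _ "e # es"]) (auto simp: awalk_Cons_iff)
qed simp

lemma (in graph) adjacency: "adjacency (dominates G)"
  using arcs_ends_symmetric[OF sym_arcs] adj_not_same by unfold_locales blast+

text \<open>The closing arc replaces the one by which a path has fewer arcs than vertices, so the
  cycle has as many arcs as the path has vertices.\<close>

lemma (in graph) cycle_of_upath:
  assumes p: "adjacency.upath (dominates G) u v p" "set p \<subseteq> verts G"
    and e: "e \<in> arcs G" "tail G e = v" "head G e = u"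
  shows "\<exists>c. cycle c \<and> length c = length p \<and> edge_of G e \<in> edge_of G ` set c"
proof -
  interpret adjacency "dominates G" by (rule adjacency)
  obtain es where es: "awalk u es v" "awalk_verts u es = p"
    using ex_awalk_of_successively[of p] p unfolding upath_def by auto
  \<comment> \<open>The closed walk is based at \<open>v\<close>; dropping this first vertex leaves
    exactly the path \<open>p\<close>, which gives distinctness.\<close>
  have "cycle (e # es)"
    unfolding cycle_def using es e p(1)
    by (intro exI[of _ v]) (auto simp: awalk_Cons_iff upath_def)
  moreover have "length (e # es) = length p"
    using length_awalk_verts[of u es] es by simp
  ultimately show ?thesis by (intro exI[of _ "e # es"]) auto
qed

lemma (in graph) sparse_free_verts:
  assumes "[4,2]-graph G"
  shows "adjacency.sparse_free (dominates G) (verts G)"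
proof -
  interpret adjacency "dominates G" by (rule adjacency)
  show ?thesis
    unfolding sparse_free_def
  proof (intro allI impI, rule ccontr)
    fix a b c d
    assume sub: "{a, b, c, d} \<subseteq> verts G" and dist: "distinct [a, b, c, d]"
      and no: "\<not> (a \<rightarrow>\<^bsub>G\<^esub> c \<or> a \<rightarrow>\<^bsub>G\<^esub> d \<or> b \<rightarrow>\<^bsub>G\<^esub> c \<or> b \<rightarrow>\<^bsub>G\<^esub> d \<or> c \<rightarrow>\<^bsub>G\<^esub> d)"
    let ?H = "G \<restriction> {a, b, c, d}"
    have no': "\<not> (c \<rightarrow>\<^bsub>G\<^esub> a \<or> d \<rightarrow>\<^bsub>G\<^esub> a \<or> c \<rightarrow>\<^bsub>G\<^esub> b \<or> d \<rightarrow>\<^bsub>G\<^esub> b \<or> d \<rightarrow>\<^bsub>G\<^esub> c)" using no sym by blast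
    \<comment> \<open>Edges are sets of two ends, so the two opposite arcs between \<open>a\<close>
      and \<open>b\<close> count once.\<close>
    have "edges ?H \<subseteq> {{a, b}}"
    proof
      fix f assume "f \<in> edges ?H"
      then obtain e where e: "e \<in> arcs G" "tail G e \<in> {a, b, c, d}" "head G e \<in> {a, b, c, d}"
        "f = {tail G e, head G e}"
        by (auto simp: edges_def edge_of_def)
      have "tail G e \<rightarrow>\<^bsub>G\<^esub> head G e" using e(1) by (auto simp: arcs_ends_conv)
      moreover have "tail G e \<noteq> head G e" using e(1) by (rule no_loops)
      ultimately show "f \<in> {{a, b}}" using e(2-4) no no' by auto
    qed
    then have "card (edges ?H) \<le> card {{a, b}}" by (intro card_mono) auto
    moreover have "2 \<le> card (edges ?H)"
      using assms induced_induce[OF sub] dist unfolding bracket_graph_def by simp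
    ultimately show False by simp
  qed
qed

text \<open>If no edge joins \<open>X\<close> and \<open>Y\<close>, a walk that avoids
  \<open>s\<close> and starts in \<open>X\<close> never leaves \<open>X\<close>, whereas
  connectedness provides one that ends in \<open>Y\<close>.\<close>

lemma (in graph) biconn_verts:
  assumes "k_connected 2 G"
  shows "adjacency.biconn (dominates G) (verts G)"
proof -
  interpret adjacency "dominates G" by (rule adjacency)
  show ?thesis
    unfolding biconn_def
  proof (intro ballI allI impI, rule ccontr)
    fix s X Y
    assume s: "s \<in> verts G" and XY: "X \<noteq> {}" "Y \<noteq> {}" "X \<inter> Y = {}" "X \<union> Y = verts G - {s}"
      and no: "\<not> (\<exists>x\<in>X. \<exists>y\<in>Y. x \<rightarrow>\<^bsub>G\<^esub> y)"
    let ?H = "mk_symmetric (G \<restriction> (verts G - {s}))"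
    \<comment> \<open>Both directions are needed, since \<open>connected\<close> speaks of walks in
      the symmetric closure.\<close>
    have no_edge: "y \<in> X" if "x \<in> X" "y \<in> verts G - {s}" "x \<rightarrow>\<^bsub>G\<^esub> y \<or> y \<rightarrow>\<^bsub>G\<^esub> x" for x y
      using that no sym XY by blast
    obtain x y where xy: "x \<in> X" "y \<in> Y" using XY by blast
    have "connected (G \<restriction> (verts G - {s}))"
      using assms s unfolding k_connected_def by simp
    moreover have "x \<in> verts ?H" "y \<in> verts ?H" using xy XY by (auto simp: mk_symmetric_def)
    ultimately have "x \<rightarrow>\<^sup>*\<^bsub>?H\<^esub> y"
      unfolding connected_def strongly_connected_def by blast
    then have "y \<in> X"
      unfolding reachable_def
    proof (induction rule: rtrancl_on_induct)
      case base
      show ?case by (rule xy)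
    next
      case (step y z)
      then obtain e where "e \<in> arcs G" "tail G e \<noteq> s" "head G e \<noteq> s"
        "(y, z) = (tail G e, head G e) \<or> (z, y) = (tail G e, head G e)"
        by (auto simp: arcs_ends_conv parcs_mk_symmetric)
      then show ?case using no_edge[OF step.IH, of z] by (auto simp: arcs_ends_conv)
    qed
    with xy XY show False by blast
  qed
qed

theorem theorem5:
  fixes G :: "('a, 'b) pre_digraph"
  assumes "graph G"
    and "k_connected 2 G"
    and "[4,2]-graph G"
    and "card (verts G) \<ge> 7"
  shows "\<exists>e. pancyclic_edge G e"
proof -
  interpret graph G by (rule assms)
  interpret adjacency "dominates G" by (rule adjacency)
  have "\<exists>u v. pancyclic_pair (verts G) u v"
    using finite_verts assms(4) sparse_free_verts[OF assms(3)] biconn_verts[OF assms(2)]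
    by (rule ex_pancyclic_pair)
  then obtain u v where uv: "pancyclic_pair (verts G) u v" by blast
  \<comment> \<open>The path runs from \<open>u\<close> to \<open>v\<close>, so the arc chosen to
    represent the edge is the one leading back from \<open>v\<close> to \<open>u\<close>.\<close>
  then have "v \<rightarrow>\<^bsub>G\<^esub> u" by (simp add: pancyclic_pair_def sym)
  then obtain e where e: "e \<in> arcs G" "tail G e = v" "head G e = u" by (rule reachableE)
  have "pancyclic_edge G (edge_of G e)"
    unfolding pancyclic_edge_def
  proof (intro conjI allI impI)
    show "edge_of G e \<in> edges G" using e(1) by (simp add: edges_def)
  next
    fix k assume "3 \<le> k \<and> k \<le> card (verts G)"
    then obtain p where p: "upath u v p" "set p \<subseteq> verts G" "length p = k"
      using uv unfolding pancyclic_pair_def by metis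
    show "\<exists>c. cycle c \<and> length c = k \<and> edge_of G e \<in> edge_of G ` set c"
      using cycle_of_upath[OF p(1,2) e] unfolding p(3) .
  qed
  then show ?thesis by (rule exI)
qed

end
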